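(* Let $a$ be a ($C^\infty$-)smooth boundary point of a $\mathbb C$-convex domain $D\subset\mathbb C^n$ and let $X\in\mathbb C^n\setminus\{0\}$ with $l_{a,X}<\infty$. Denote by $n_a$ the inner normal to $\partial D$ at $a$. Then there exist a neighborhood $U$ of $a$ and a constant $c>0$ such that $$c^{-1}\,d_D(z)^{-1/l_{a,X}}\le\gamma_D(z;X)\le\kappa_D(z;X)\le c\,d_D(z)^{-1/l_{a,X}},\qquad z\in D\cap U\cap n_a.$$
   Context: A domain $D\subset\mathbb C^n$ is $\mathbb C$-convex if every non-empty intersection of $D$ with a complex (affine) line is a simply connected domain (in particular connected). A smooth boundary point $a$ is one near which $\partial D$ is a $C^\infty$ hypersurface, i.e. there is a $C^\infty$ function $r$ near $a$ with $dr(a)\neq0$ and $D=\{r<0\}$ near $a$. The number $l_{a,X}$ is the order of contact at $a$ of $\partial D$ with the complex line through $a$ in direction $X$, i.e. the order of vanishing at $\zeta=0$ of $\zeta\mapsto r(a+\zeta X)$, $\zeta\in\mathbb C$ (possibly $\infty$). The inner normal $n_a$ is the real half-line starting at $a$ in the direction of the inner normal vector to $\partial D$ at $a$; $d_D(z)=\operatorname{dist}(z,\partial D)$. Let $\mathbb D\subset\mathbb C$ be the unit disc and $\mathcal O(A,B)$ the set of holomorphic maps $A\to B$. The Carathéodory (pseudo)metric is $\gamma_D(z;X)=\sup\{|f'(z)X|: f\in\mathcal O(D,\mathbb D),\ f(z)=0\}$; the Kobayashi (pseudo)metric is $\kappa_D(z;X)=\inf\{\alpha\ge0:\exists\varphi\in\mathcal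 O(\mathbb D,D):\varphi(0)=z,\ \alpha\varphi'(0)=X\}$. *)

theory Defs
  imports "HOL-Complex_Analysis.Complex_Analysis" "HOL-Library.Extended_Nat"
begin

definition complex_line :: "complex ^ 'n \<Rightarrow> complex ^ 'n \<Rightarrow> (complex ^ 'n) set" where
  "complex_line p v = range (\<lambda>\<zeta>. p + \<zeta> *s v)"

definition domain :: "'a::topological_space set \<Rightarrow> bool" where
  "domain D \<longleftrightarrow> open D \<and> connected D \<and> D \<noteq> {}"

text \<open>For open \<open>D\<close> the sections below are automatically relatively open, and
  \<^const>\<open>simply_connected\<close> includes path-connectedness.\<close>

definition C_convex :: "(complex ^ 'n) set \<Rightarrow> bool" where
  "C_convex D \<longleftrightarrow>
     (\<forall>p v. v \<noteq> 0 \<longrightarrow> D \<inter> complex_line p v \<noteq> {} \<longrightarrow> simply_connected (D \<inter> complex_line p v))"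

text \<open>Iterated real directional derivatives; the head of the list is the last direction
  of differentiation.\<close>

primrec iter_deriv ::
  "('a::real_normed_vector \<Rightarrow> real) \<Rightarrow> 'a list \<Rightarrow> 'a \<Rightarrow> real" where
  "iter_deriv f [] = f"
| "iter_deriv f (v # vs) = (\<lambda>x. frechet_derivative (iter_deriv f vs) (at x) v)"

text \<open>\<open>C\<^sup>\<infinity>\<close> on an open set. Continuity of all the derivatives follows from their
  differentiability.\<close>

definition smooth_on :: "('a::real_normed_vector \<Rightarrow> real) \<Rightarrow> 'a set \<Rightarrow> bool" where
  "smooth_on f U \<longleftrightarrow> (\<forall>vs. \<forall>x\<in>U. iter_deriv f vs differentiable (at x))"

text \<open>The least order of a nonzero derivative of \<open>f\<close> at \<open>x\<close> (order \<open>0\<close> being the value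
  of \<open>f\<close>), in all real directions; the infimum of the empty set is \<open>\<infinity>\<close>.\<close>

definition vanishing_order :: "('a::real_normed_vector \<Rightarrow> real) \<Rightarrow> 'a \<Rightarrow> enat" where
  "vanishing_order f x = Inf {enat (length vs) | vs. iter_deriv f vs x \<noteq> 0}"

text \<open>The boundary point \<open>a\<close> of \<open>D\<close> is smooth iff such an \<open>r\<close> exists.\<close>

definition local_defining_function ::
  "(complex ^ 'n \<Rightarrow> real) \<Rightarrow> (complex ^ 'n) set \<Rightarrow> complex ^ 'n \<Rightarrow> bool" where
  "local_defining_function r D a \<longleftrightarrow>
     a \<in> frontier D \<and>
     frechet_derivative r (at a) \<noteq> (\<lambda>_. 0) \<and>
     (\<exists>U. open U \<and> a \<in> U \<and> smooth_on r U \<and> D \<inter> U = {z \<in> U. r z < 0})"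

text \<open>The numbers \<open>l\<^sub>a\<^sub>,\<^sub>X\<close>; mathematically independent of the choice of the local
  defining function.\<close>

definition line_contact_order ::
  "(complex ^ 'n \<Rightarrow> real) \<Rightarrow> complex ^ 'n \<Rightarrow> complex ^ 'n \<Rightarrow> enat" where
  "line_contact_order r a X = vanishing_order (\<lambda>\<zeta>::complex. r (a + \<zeta> *s X)) 0"

text \<open>The gradient is taken for the real inner product on \<open>\<complex>\<^sup>n = \<real>\<^sup>2\<^sup>n\<close>; it points out of
  \<open>{r < 0}\<close>.\<close>

definition inner_normal ::
  "(complex ^ 'n \<Rightarrow> real) \<Rightarrow> complex ^ 'n \<Rightarrow> (complex ^ 'n) set" where
  "inner_normal r a = {a - t *\<^sub>R v | t v. 0 \<le> t \<and> GDERIV r a :> v}"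

abbreviation boundary_dist :: "(complex ^ 'n) set \<Rightarrow> complex ^ 'n \<Rightarrow> real" where
  "boundary_dist D z \<equiv> infdist z (frontier D)"

text \<open>Holomorphy in several variables: Frechet differentiable with complex-linear derivative.\<close>

definition holomorphic_fun_on ::
  "(complex ^ 'n \<Rightarrow> complex) \<Rightarrow> (complex ^ 'n) set \<Rightarrow> bool" where
  "holomorphic_fun_on f D \<longleftrightarrow>
     (\<forall>z\<in>D. \<exists>L. (f has_derivative L) (at z) \<and> (\<forall>c v. L (c *s v) = c * L v))"

definition holomorphic_disc :: "(complex \<Rightarrow> complex ^ 'n) \<Rightarrow> bool" where
  "holomorphic_disc \<phi> \<longleftrightarrow> (\<forall>i. (\<lambda>\<zeta>. \<phi> \<zeta> $ i) holomorphic_on ball 0 1)"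

definition disc_deriv :: "(complex \<Rightarrow> complex ^ 'n) \<Rightarrow> complex \<Rightarrow> complex ^ 'n" where
  "disc_deriv \<phi> \<zeta> = (\<chi> i. deriv (\<lambda>w. \<phi> w $ i) \<zeta>)"

text \<open>For \<open>D\<close> open and \<open>z \<in> D\<close> the next two sets are nonempty and bounded (above and below,
  respectively), so the real supremum and infimum are the intended ones.\<close>

definition caratheodory_metric ::
  "(complex ^ 'n) set \<Rightarrow> complex ^ 'n \<Rightarrow> complex ^ 'n \<Rightarrow> real" where
  "caratheodory_metric D z X =
     Sup {norm (frechet_derivative f (at z) X) | f.
            holomorphic_fun_on f D \<and> f ` D \<subseteq> ball 0 1 \<and> f z = 0}"

definition kobayashi_metric ::
  "(complex ^ 'n) set \<Rightarrow> complex ^ 'n \<Rightarrow> complex ^ 'n \<Rightarrow> real" where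
  "kobayashi_metric D z X =
     Inf {\<alpha>. 0 \<le> \<alpha> \<and> (\<exists>\<phi>. holomorphic_disc \<phi> \<and> \<phi> ` ball 0 1 \<subseteq> D \<and>
                        \<phi> 0 = z \<and> \<alpha> *\<^sub>R disc_deriv \<phi> 0 = X)}"

end

theory Submission
  imports Defs
begin

text \<open>By \<open>\<complex>\<close>-convexity the complex tangent hyperplane at a smooth boundary point \<open>b\<close> misses
  \<open>D\<close>, and an affine function \<open>g\<close> without zeros on \<open>D\<close> has a holomorphic logarithm that is
  constant on the fibres of \<open>g\<close>. Taking for \<open>g\<close> the equation of that hyperplane at a boundary
  point \<open>b = z + \<mu>X\<close>, its square root yields a function from \<open>D\<close> to the unit disc whose derivative at
  \<open>z\<close> in direction \<open>X\<close> is at least \<open>\<rho> / (48 |\<mu>|\<^sup>2)\<close>, where \<open>\<rho>\<close> is the radius of a disc around \<open>z\<close>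
  in \<open>D \<inter> (z + \<complex>X)\<close>; that same disc bounds the Kobayashi metric by \<open>1 / \<rho>\<close>.
  On the inner normal both \<open>\<rho>\<close> and \<open>|\<mu>|\<close> can be chosen comparable to the \<open>l\<close>-th root of the distance to
  the boundary: the upper bound on \<open>r (a + \<zeta>X)\<close> is Taylor's theorem, and the lower
  bound (for \<open>l > 1\<close>) comes from finite differences, since some derivative of order \<open>l\<close> does not vanish
  while \<open>r \<ge> 0\<close> on the complex tangent space.\<close>

section \<open>Logarithms along a family of simply connected slices\<close>

text \<open>The values of \<open>d\<close> lie in the discrete set of integer multiples of 2 pi i,
  where a continuous function on a connected set cannot jump. Two continuous logarithms of the same
  function are always compared through this lemma.\<close>

lemma exp_eq_1_constant:
  fixes d :: "'a::topological_space \<Rightarrow> complex"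
  assumes "connected S" "continuous_on S d" "\<And>u. u \<in> S \<Longrightarrow> exp (d u) = 1" "u \<in> S" "v \<in> S"
  shows "d u = d v"
proof -
  have "d constant_on S"
  proof (rule continuous_discrete_range_constant[OF assms(1,2)])
    fix x assume x: "x \<in> S"
    have "2 * pi \<le> norm (d y - d x)" if y: "y \<in> S" "d y \<noteq> d x" for y
    proof -
      have e: "exp (d y) = exp (d x)" using assms(3) x y by simp
      then have "2 * pi \<le> \<bar>Im (d y) - Im (d x)\<bar>"
        using exp_complex_eqI[OF _ e] y(2) by linarith
      then show ?thesis using abs_Im_le_cmod[of "d y - d x"] by simp
    qed
    then show "\<exists>e>0. \<forall>y. y \<in> S \<and> d y \<noteq> d x \<longrightarrow> e \<le> norm (d y - d x)"
      by (intro exI[of _ "2*pi"]) auto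
  qed
  then show ?thesis using assms(4,5) by (auto simp: constant_on_def)
qed

text \<open>The logarithm on each slice is continued from the base point \<open>\<alpha> t\<close>. It is jointly continuous
  because a path from \<open>\<alpha> t0\<close> to \<open>s0\<close> in one slice can be perturbed to paths in all nearby slices,
  along which the two logarithms differ by the principal logarithm of a quotient close to \<open>1\<close>.\<close>

lemma fibrewise_logarithm:
  fixes W :: "('a::metric_space \<times> complex) set" and F :: "'a \<times> complex \<Rightarrow> complex"
  assumes W: "open W" and F: "continuous_on W F" and F0: "\<And>x. x \<in> W \<Longrightarrow> F x \<noteq> 0"
    and sc: "\<And>t. simply_connected {s. (t, s) \<in> W}"
    and \<alpha>: "continuous_on (fst ` W) \<alpha>" "\<And>t. t \<in> fst ` W \<Longrightarrow> (t, \<alpha> t) \<in> W"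
    and c: "continuous_on (fst ` W) c" "\<And>t. t \<in> fst ` W \<Longrightarrow> exp (c t) = F (t, \<alpha> t)"
  obtains G where "continuous_on W G" "\<And>x. x \<in> W \<Longrightarrow> exp (G x) = F x"
proof -
  define Sl where "Sl t = {s. (t, s) \<in> W}" for t
  have oSl: "open (Sl t)" for t
  proof -
    have "Sl t = Pair t -` W" by (auto simp: Sl_def)
    then show ?thesis using open_vimage[OF W, of "Pair t"] by (simp add: continuous_on_Pair)
  qed
  have contF: "continuous_on (Sl t) (\<lambda>s. F (t, s))" for t
    by (rule continuous_on_compose2[OF F]) (auto simp: Sl_def intro!: continuous_intros)
  have "\<exists>g. continuous_on (Sl t) g \<and> (\<forall>s\<in>Sl t. exp (g s) = F (t, s)) \<and> g (\<alpha> t) = c t"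
    if t: "t \<in> fst ` W" for t
  proof -
    obtain g where g: "continuous_on (Sl t) g" "\<And>s. s \<in> Sl t \<Longrightarrow> F (t, s) = exp (g s)"
      using continuous_logarithm_on_simply_connected[OF contF, of t]
        sc[of t] F0 open_imp_locally_path_connected[OF oSl[of t]]
      by (auto simp: Sl_def)
    \<comment> \<open>The shift by \<open>c t - g (\<alpha> t)\<close> is a multiple of 2 pi i, so
      it keeps a logarithm and prescribes its value at the base point.\<close>
    have "exp (c t - g (\<alpha> t)) = 1"
      using \<alpha>(2)[OF t] c(2)[OF t] g(2)[of "\<alpha> t"] by (simp add: exp_diff Sl_def)
    then show ?thesis
      using g by (intro exI[of _ "\<lambda>s. g s + (c t - g (\<alpha> t))"])
         (auto simp: exp_add intro!: continuous_intros)
  qed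
  then obtain g where g: "\<And>t. t \<in> fst ` W \<Longrightarrow> continuous_on (Sl t) (g t)"
     "\<And>t s. t \<in> fst ` W \<Longrightarrow> s \<in> Sl t \<Longrightarrow> exp (g t s) = F (t, s)"
     "\<And>t. t \<in> fst ` W \<Longrightarrow> g t (\<alpha> t) = c t"
    by metis
  define G where "G x = g (fst x) (snd x)" for x
  have cont_\<alpha>fst: "continuous_on W (\<lambda>x. \<alpha> (fst x))"
    by (rule continuous_on_compose2[OF \<alpha>(1)]) (auto intro!: continuous_on_fst continuous_on_id)
  have "continuous_on W G"
  proof (subst continuous_on_eq_continuous_within, intro ballI)
    fix x0 assume x0: "x0 \<in> W"
    obtain t0 s0 where ts0: "x0 = (t0, s0)" by force
    have t0: "t0 \<in> fst ` W" and s0: "s0 \<in> Sl t0" using x0 by (force simp: ts0 Sl_def)+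
    have a0: "\<alpha> t0 \<in> Sl t0" using \<alpha>(2)[OF t0] by (simp add: Sl_def)
    have "path_connected (Sl t0)" using sc[of t0] by (simp add: Sl_def simply_connected_imp_path_connected)
    then obtain P where P: "path P" "path_image P \<subseteq> Sl t0" "pathstart P = \<alpha> t0" "pathfinish P = s0"
      using a0 s0 unfolding path_connected_def by metis
    have contP: "continuous_on {0..1} P" using P(1) by (simp add: path_def)
    have P_Sl: "(t0, P u) \<in> W" if "u \<in> {0..1}" for u
      using P(2) that unfolding path_image_def Sl_def by blast
    have "compact ({t0} \<times> path_image P)"
      using P(1) by (intro compact_Times compact_path_image) auto
    moreover have "{t0} \<times> path_image P \<subseteq> W" using P(2) by (auto simp: Sl_def)
    ultimately obtain e where e: "e > 0" "(\<Union>x\<in>{t0} \<times> path_image P. ball x e) \<subseteq> W"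
      using compact_subset_open_imp_ball_epsilon_subset[OF _ W] by metis
    define U where "U = {x \<in> W. dist (fst x) t0 < e/4 \<and> dist (\<alpha> (fst x)) (\<alpha> t0) < e/4 \<and> dist (snd x) s0 < e/4}"
    \<comment> \<open>\<open>Pt x\<close> is \<open>P\<close> with both ends moved: it runs from
      \<open>\<alpha> (fst x)\<close> to \<open>snd x\<close>, and the displacement is interpolated
      linearly. In \<open>U\<close> it is less than \<open>e/2\<close>, which together with
      \<open>e/4\<close> for the first coordinate stays in the tube of radius \<open>e\<close>
      inside \<open>W\<close>.\<close>
    define Pt where "Pt x u = P u + (1 - complex_of_real u) * (\<alpha> (fst x) - \<alpha> t0) + complex_of_real u * (snd x - s0)" for x u
    have PtW: "(fst x, Pt x u) \<in> W" if x: "x \<in> U" and u: "u \<in> {0..1}" for x u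
    proof -
      have u': "norm (1 - complex_of_real u) \<le> 1" "norm (complex_of_real u) \<le> 1"
        using u norm_of_real[of "1 - u", where 'a=complex] by auto
      have "norm (Pt x u - P u) \<le> norm ((1 - complex_of_real u) * (\<alpha> (fst x) - \<alpha> t0)) + norm (complex_of_real u * (snd x - s0))"
        unfolding Pt_def by (metis (no_types, lifting) add.assoc add_diff_cancel_left' norm_triangle_ineq)
      also have "\<dots> \<le> 1 * norm (\<alpha> (fst x) - \<alpha> t0) + 1 * norm (snd x - s0)"
        unfolding norm_mult by (intro add_mono mult_right_mono u') auto
      also have "\<dots> < e/4 + e/4" using x by (auto simp: U_def dist_norm)
      finally have 1: "dist (Pt x u) (P u) < e/2" by (simp add: dist_norm)
      have "dist (t0, P u) (fst x, Pt x u) \<le> dist t0 (fst x) + dist (P u) (Pt x u)"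
        unfolding dist_Pair_Pair by (rule sqrt_sum_squares_le_sum) auto
      also have "\<dots> < e/4 + e/2" using 1 x by (auto simp: U_def dist_commute)
      also have "\<dots> < e" using e by simp
      finally have "(fst x, Pt x u) \<in> ball (t0, P u) e" by simp
      moreover have "(t0, P u) \<in> {t0} \<times> path_image P" using u by (auto simp: path_image_def)
      ultimately show ?thesis using e(2) by blast
    qed
    have contfst: "continuous_on U (\<lambda>x. \<alpha> (fst x))"
      by (rule continuous_on_compose2[OF \<alpha>(1)]) (auto simp: U_def intro!: continuous_on_fst continuous_on_id)
    have contfst2: "continuous_on (U \<times> {0..1}) (\<lambda>x. \<alpha> (fst (fst x)))"
      by (rule continuous_on_compose2[OF \<alpha>(1)]) (auto simp: U_def intro!: continuous_on_fst continuous_on_id)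
    have contP2: "continuous_on (U \<times> {0..1}) (\<lambda>x. P (snd x))"
      by (rule continuous_on_compose2[OF contP]) (auto intro!: continuous_on_fst continuous_on_snd continuous_on_id)
    define fx where "fx = (\<lambda>(x, u). F (fst x, Pt x u))"
    have contPt2: "continuous_on (U \<times> {0..1}) (\<lambda>x. Pt (fst x) (snd x))"
      unfolding Pt_def by (intro contfst2 contP2 continuous_intros)
    have contfx: "continuous_on (U \<times> {0..1}) fx"
      unfolding fx_def case_prod_unfold
    proof (rule continuous_on_compose2[OF F])
      show "continuous_on (U \<times> {0..1}) (\<lambda>x. (fst (fst x), Pt (fst x) (snd x)))"
        by (intro contPt2 continuous_intros)
      show "(\<lambda>x. (fst (fst x), Pt (fst x) (snd x))) ` (U \<times> {0..1}) \<subseteq> W"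
        using PtW by fastforce
    qed
    have x0U: "x0 \<in> U" using x0 e by (auto simp: U_def ts0)
    have cF0: "continuous_on {0..1} (\<lambda>u. F (t0, P u))"
      by (rule continuous_on_compose2[OF F]) (auto simp: P_Sl intro!: contP continuous_intros)
    have "\<exists>u0\<in>{0..1}. \<forall>u\<in>{0..1}. norm (F (t0, P u0)) \<le> norm (F (t0, P u))"
      by (intro continuous_attains_inf continuous_on_norm cF0) auto
    then obtain u0 where u0: "u0 \<in> {0..1}" "\<And>u. u \<in> {0..1} \<Longrightarrow> norm (F (t0, P u0)) \<le> norm (F (t0, P u))"
      by blast
    \<comment> \<open>\<open>m0\<close> is the minimum of the modulus of \<open>F\<close> along
      \<open>P\<close>. Values of \<open>F\<close> on the two paths that differ by at most
      \<open>m0 / 2\<close> have a quotient within \<open>1/2\<close> of \<open>1\<close>, where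
      \<open>Ln\<close> is continuous.\<close>
    define m0 where "m0 = norm (F (t0, P u0))"
    have m0p: "m0 > 0" using F0 P_Sl[OF u0(1)] by (simp add: m0_def)
    obtain X0 where X0: "x0 \<in> X0" "open X0"
      "\<forall>x\<in>X0 \<inter> U. \<forall>u \<in> {0..1}. dist (fx (x, u)) (fx (x0, u)) \<le> m0 / 2"
      by (rule continuous_on_prod_compactE[OF contfx compact_Icc x0U half_gt_zero[OF m0p]])
    have fx0: "fx (x0, u) = F (t0, P u)" for u by (simp add: fx_def ts0 Pt_def)
    \<comment> \<open>Equating the difference \<open>d\<close> of the logarithms at the two ends of
      the paths expresses \<open>G x\<close> by terms that are visibly continuous at
      \<open>x0\<close>.\<close>
    have key: "G x = G x0 + Ln (F x / F x0) + (c (fst x) - c t0) - Ln (F (fst x, \<alpha> (fst x)) / F (t0, \<alpha> t0))"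
      if x: "x \<in> X0 \<inter> U" for x
    proof -
      obtain t s where ts: "x = (t, s)" by force
      have xW: "x \<in> W" using x by (auto simp: U_def)
      have t: "t \<in> fst ` W" using xW by (force simp: ts)
      have Pt01: "Pt x 0 = \<alpha> t" "Pt x 1 = s" using P(3,4) by (simp_all add: Pt_def ts pathstart_def pathfinish_def)
      define R where "R u = fx (x, u) / F (t0, P u)" for u
      have Rpos: "Re (R u) > 0" if u: "u \<in> {0..1}" for u
      proof -
        have n0: "norm (F (t0, P u)) \<ge> m0" using u0(2)[OF u] by (simp add: m0_def)
        then have nz: "F (t0, P u) \<noteq> 0" using m0p by auto
        have "norm (R u - 1) = norm (fx (x, u) - F (t0, P u)) / norm (F (t0, P u))"
          using nz by (simp add: R_def divide_simps flip: norm_divide)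
        also have "norm (fx (x, u) - F (t0, P u)) \<le> m0 / 2"
          using X0(3) x u by (auto simp: fx0 dist_norm)
        also have "m0 / 2 / norm (F (t0, P u)) \<le> 1 / 2" using n0 m0p nz by (simp add: divide_simps)
        finally have "norm (R u - 1) \<le> 1/2" using m0p n0 by (simp add: divide_right_mono)
        then show ?thesis using abs_Re_le_cmod[of "R u - 1"] by simp
      qed
      have contR: "continuous_on {0..1} R"
        unfolding R_def
      proof (intro continuous_intros cF0)
        show "continuous_on {0..1} (\<lambda>u. fx (x, u))"
          by (rule continuous_on_compose2[OF contfx]) (use x in \<open>auto intro!: continuous_intros\<close>)
      qed (use F0 P_Sl in auto)
      have contPt: "continuous_on {0..1} (Pt x)"
        unfolding Pt_def by (intro continuous_intros contP)
      define d where "d u = g t (Pt x u) - g t0 (P u) - Ln (R u)" for u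
      have "d 0 = d 1"
      proof (rule exp_eq_1_constant[of "{0..1}" d])
        have "continuous_on {0..1} (\<lambda>u. g t (Pt x u))"
          by (rule continuous_on_compose2[OF g(1)[OF t] contPt])
            (use PtW x in \<open>auto simp: Sl_def ts\<close>)
        moreover have "continuous_on {0..1} (\<lambda>u. g t0 (P u))"
          by (rule continuous_on_compose2[OF g(1)[OF t0] contP])
            (use P_Sl in \<open>auto simp: Sl_def\<close>)
        moreover have "continuous_on {0..1} (\<lambda>u. Ln (R u))"
          by (rule continuous_on_Ln'[OF contR]) (use Rpos in \<open>force simp: complex_nonpos_Reals_iff\<close>)
        ultimately show "continuous_on {0..1} d" unfolding d_def by (intro continuous_on_diff)
        fix u :: real assume u: "u \<in> {0..1}"
        have "R u \<noteq> 0" using Rpos[OF u] by auto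
        moreover have "exp (g t (Pt x u)) = fx (x, u)"
          using g(2)[OF t] PtW[of x u] u x by (simp add: Sl_def ts fx_def)
        moreover have "exp (g t0 (P u)) = F (t0, P u)"
          using g(2)[OF t0] P_Sl[of u] u by (simp add: Sl_def)
        moreover have "F (t0, P u) \<noteq> 0" using F0 P_Sl[OF u] by simp
        ultimately show "exp (d u) = 1"
          by (auto simp: d_def exp_diff R_def)
      qed auto
      then show ?thesis
        using P(3,4) g(3)[OF t] g(3)[OF t0]
        by (simp add: d_def Pt01[unfolded ts] R_def fx_def G_def ts ts0 pathstart_def pathfinish_def algebra_simps)
    qed
    have ev: "eventually (\<lambda>x. x \<in> X0 \<inter> U) (at x0 within W)"
    proof -
      have c1: "((\<lambda>x. \<alpha> (fst x)) \<longlongrightarrow> \<alpha> t0) (at x0 within W)"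
      proof -
        show ?thesis using cont_\<alpha>fst x0 by (auto simp: continuous_on_def ts0)
      qed
      have c2: "((\<lambda>x. fst x) \<longlongrightarrow> t0) (at x0 within W)" "((\<lambda>x. snd x) \<longlongrightarrow> s0) (at x0 within W)"
        by (auto simp: ts0 intro!: tendsto_eq_intros)
      have "eventually (\<lambda>x. x \<in> X0) (at x0 within W)"
        using X0 by (intro eventually_at_topological[THEN iffD2] exI[of _ X0]) auto
      moreover have "eventually (\<lambda>x. x \<in> W) (at x0 within W)"
        by (auto simp: eventually_at_filter)
      moreover note tendstoD[OF c1, of "e/4"] tendstoD[OF c2(1), of "e/4"] tendstoD[OF c2(2), of "e/4"]
      ultimately have "eventually (\<lambda>x. x \<in> X0 \<and> x \<in> W \<and> dist (\<alpha> (fst x)) (\<alpha> t0) < e/4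
          \<and> dist (fst x) t0 < e/4 \<and> dist (snd x) s0 < e/4) (at x0 within W)"
        using e(1) by (intro eventually_conj) auto
      then show ?thesis by (rule eventually_mono) (auto simp: U_def)
    qed
    have F_lim: "(F \<longlongrightarrow> F x0) (at x0 within W)" using F x0 by (auto simp: continuous_on_def)
    have Fa_lim: "((\<lambda>x. F (fst x, \<alpha> (fst x))) \<longlongrightarrow> F (t0, \<alpha> t0)) (at x0 within W)"
    proof -
      have "continuous_on W (\<lambda>x. F (fst x, \<alpha> (fst x)))"
        by (rule continuous_on_compose2[OF F])
           (auto intro!: \<alpha>(2) continuous_on_Pair continuous_on_fst continuous_on_id cont_\<alpha>fst)
      then show ?thesis using x0 by (auto simp: continuous_on_def ts0)
    qed
    have c_lim: "((\<lambda>x. c (fst x)) \<longlongrightarrow> c t0) (at x0 within W)"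
    proof -
      have "continuous_on W (\<lambda>x. c (fst x))"
        by (rule continuous_on_compose2[OF c(1)]) (auto intro!: continuous_on_fst continuous_on_snd continuous_on_id)
      then show ?thesis using x0 by (auto simp: continuous_on_def ts0)
    qed
    have nz: "F x0 \<noteq> 0" "F (t0, \<alpha> t0) \<noteq> 0" using F0 x0 \<alpha>(2)[OF t0] by auto
    have l1: "((\<lambda>x. F x / F x0) \<longlongrightarrow> 1) (at x0 within W)"
      using tendsto_divide[OF F_lim tendsto_const nz(1)] nz by simp
    have l2: "((\<lambda>x. F (fst x, \<alpha> (fst x)) / F (t0, \<alpha> t0)) \<longlongrightarrow> 1) (at x0 within W)"
      using tendsto_divide[OF Fa_lim tendsto_const nz(2)] nz by simp
    have "((\<lambda>x. G x0 + Ln (F x / F x0) + (c (fst x) - c t0) - Ln (F (fst x, \<alpha> (fst x)) / F (t0, \<alpha> t0)))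
        \<longlongrightarrow> G x0 + Ln 1 + (c t0 - c t0) - Ln 1) (at x0 within W)"
      by (intro tendsto_intros l1 l2 c_lim) (auto simp: complex_nonpos_Reals_iff)
    then have "((\<lambda>x. G x0 + Ln (F x / F x0) + (c (fst x) - c t0) - Ln (F (fst x, \<alpha> (fst x)) / F (t0, \<alpha> t0)))
        \<longlongrightarrow> G x0) (at x0 within W)" by simp
    then have "(G \<longlongrightarrow> G x0) (at x0 within W)"
    proof (rule Lim_transform_eventually)
      show "eventually (\<lambda>x. G x0 + Ln (F x / F x0) + (c (fst x) - c t0) - Ln (F (fst x, \<alpha> (fst x)) / F (t0, \<alpha> t0)) = G x)
         (at x0 within W)"
        using ev by (rule eventually_mono) (rule key[symmetric])
    qed
    then show "continuous (at x0 within W) G" by (simp add: continuous_within)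
  qed
  moreover have "exp (G x) = F x" if "x \<in> W" for x
    using g(2)[of "fst x" "snd x"] that by (auto simp: G_def Sl_def)
  ultimately show ?thesis using that by blast
qed

section \<open>Complex lines and tangent hyperplanes\<close>

lemma norm_vector_smult: "norm (c *s x) = norm c * norm x" for x :: "complex ^ 'n"
  by (simp add: norm_vec_def norm_mult L2_set_right_distrib)

lemma linear_smult_left: "linear (\<lambda>s. s *s v)" for v :: "complex ^ 'n"
  by (rule linearI) (auto simp: vec_eq_iff algebra_simps)

lemma continuous_on_smult [continuous_intros]:
  fixes g :: "'a::topological_space \<Rightarrow> complex ^ 'n"
  assumes "continuous_on S f" "continuous_on S g"
  shows "continuous_on S (\<lambda>x. f x *s g x)"
  unfolding vector_scalar_mult_def
  by (intro continuous_on_vec_lambda continuous_on_mult assms continuous_on_component)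

text \<open>The parameter set is affinely homeomorphic to the section. For \<open>v = 0\<close> it
  is everything or empty, so directions need not be kept away from \<open>0\<close> when logarithms
  are built over families of lines.\<close>

lemma simply_connected_slice:
  assumes "C_convex D"
  shows "simply_connected {s. p + s *s v \<in> D}"
proof (cases "v = 0 \<or> D \<inter> complex_line p v = {}")
  case True
  have "simply_connected (UNIV::complex set)" by (simp add: convex_imp_simply_connected)
  moreover have "{s. p + s *s v \<in> D} = UNIV \<or> {s. p + s *s v \<in> D} = {}"
    using True by (auto simp: complex_line_def)
  ultimately show ?thesis by auto
next
  case False
  let ?S = "{s. p + s *s v \<in> D}"
  have "inj (\<lambda>s. s *s v)" using False by (auto intro!: injI simp: vector_mul_rcancel)
  then have "?S homeomorphic (\<lambda>s. s *s v) ` ?S"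
    by (rule linear_homeomorphic_image[OF linear_smult_left])
  also have "\<dots> homeomorphic (+) p ` (\<lambda>s. s *s v) ` ?S"
    by (rule homeomorphic_translation)
  also have "(+) p ` (\<lambda>s. s *s v) ` ?S = D \<inter> complex_line p v"
    by (auto simp: complex_line_def)
  finally have "simply_connected ?S \<longleftrightarrow> simply_connected (D \<inter> complex_line p v)"
    by (rule homeomorphic_simply_connected_eq)
  then show ?thesis using assms False by (auto simp: C_convex_def)
qed

text \<open>Once around the circle \<open>h\<close> returns to its initial value while the angle
  grows by 2 pi, although their difference would have to be constant.\<close>

lemma no_continuous_logarithm_on_circle:
  fixes h :: "complex \<Rightarrow> complex"
  assumes "R > 0" "continuous_on (sphere 0 R) h" "\<And>t. t \<in> sphere 0 R \<Longrightarrow> exp (h t) = t"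
  shows False
proof -
  define d where "d u = h (complex_of_real R * exp (\<i> * complex_of_real u)) - \<i> * complex_of_real u - Ln (complex_of_real R)" for u :: real
  have R: "exp (Ln (complex_of_real R)) = complex_of_real R" using assms(1) by simp
  have S: "complex_of_real R * exp (\<i> * complex_of_real u) \<in> sphere 0 R" for u
    using assms(1) by (simp add: norm_mult)
  have "d 0 = d (2 * pi)"
  proof (rule exp_eq_1_constant[of UNIV d])
    show "continuous_on UNIV d" unfolding d_def
      by (intro continuous_intros continuous_on_compose2[OF assms(2)]) (use S in auto)
    show "exp (d u) = 1" for u
      using assms(1) by (simp add: d_def exp_diff assms(3)[OF S] R)
  qed auto
  moreover have "exp (\<i> * complex_of_real (2 * pi)) = 1"
    using exp_two_pi_i by (simp add: mult_ac)
  ultimately show False by (simp add: d_def)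
qed

text \<open>If \<open>p + v\<close> were in \<open>D\<close>, then every complex line through \<open>p\<close> with direction
  \<open>v + t \<nu>\<close>, \<open>t\<close> on a small circle, would meet \<open>D\<close> both at parameter \<open>1\<close> and
  at parameter \<open>-\<epsilon>/t\<close>. As \<open>p \<notin> D\<close>, the parameter has a logarithm along each section of
  \<open>D\<close>, and normalising it by \<open>ln 1 = 0\<close> gives a continuous logarithm of \<open>-\<epsilon>/t\<close>
  on the circle.\<close>

lemma tangent_hyperplane_avoids_C_convex:
  fixes D :: "(complex ^ 'n) set" and r :: "complex ^ 'n \<Rightarrow> real"
  assumes D: "C_convex D" "open D" and p: "p \<notin> D"
    and r: "(r has_derivative L) (at p)" "r p = 0"
    and U: "open U" "p \<in> U" "{z \<in> U. r z < 0} \<subseteq> D"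
    and L: "L \<noteq> (\<lambda>_. 0)" "L v = 0" "L (\<i> *s v) = 0"
  shows "p + v \<notin> D"
proof
  assume q: "p + v \<in> D"
  interpret L: bounded_linear L using r(1) by (rule has_derivative_bounded_linear)
  obtain \<nu>0 where "L \<nu>0 \<noteq> 0" using L(1) by auto
  then obtain \<nu> where \<nu>: "L \<nu> = 1"
    using L.scaleR[of "1 / L \<nu>0" \<nu>0] by (auto simp del: L.scaleR)
  have Lv: "L (c *s v) = 0" for c
  proof -
    have "c *s v = Re c *\<^sub>R v + Im c *\<^sub>R (\<i> *s v)"
      by (auto simp: vec_eq_iff complex_eq_iff)
    then show ?thesis using L(2,3) by (simp add: L.add L.scaleR)
  qed
  have "open ((\<lambda>t. p + (v + t *s \<nu>)) -` D)"
    by (rule open_vimage[OF D(2)]) (intro continuous_intros)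
  moreover have "0 \<in> (\<lambda>t. p + (v + t *s \<nu>)) -` D" using q by simp
  ultimately obtain \<rho> where \<rho>: "\<rho> > 0" "ball 0 \<rho> \<subseteq> (\<lambda>t. p + (v + t *s \<nu>)) -` D"
    by (meson open_contains_ball)
  \<comment> \<open>On this annulus the upper bound on \<open>norm t\<close> keeps
    \<open>p + v + t *s \<nu>\<close> in \<open>D\<close>, and the lower bound gives
    \<open>1 / norm t < 2 / \<rho>\<close>, which is what makes \<open>M\<close> independent of
    \<open>t\<close>.\<close>
  define T where "T = {t::complex. \<rho>/2 < norm t \<and> norm t < \<rho>}"
  define M where "M = norm \<nu> + 2/\<rho> * norm v + 1"
  have M: "M > 0" using \<rho> by (simp add: M_def add_nonneg_pos)
  obtain d1 where d1: "d1 > 0" "ball p d1 \<subseteq> U" using U by (meson open_contains_ball)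
  obtain d2 where d2: "d2 > 0"
    "\<And>y. norm (y - p) < d2 \<Longrightarrow> norm (r y - r p - L (y - p)) \<le> 1 / (2*M) * norm (y - p)"
    using r(1) M unfolding has_derivative_at_alt by (metis (no_types) divide_pos_pos mult_pos_pos zero_less_numeral zero_less_one)
  define \<epsilon> where "\<epsilon> = min d1 d2 / (2*M)"
  have \<epsilon>: "\<epsilon> > 0" using d1 d2 M by (simp add: \<epsilon>_def)
  \<comment> \<open>The displacement equals \<open>-\<epsilon> \<nu> - (\<epsilon>/t) v\<close>.
    Since \<open>v\<close> is complex tangent, \<open>L\<close> takes the value
    \<open>-\<epsilon>\<close> on it, while its norm is below \<open>\<epsilon> * M\<close>; the
    error of the linear approximation is therefore below \<open>\<epsilon>/2\<close> and
    \<open>r\<close> is negative.\<close>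
  have B: "p + (- complex_of_real \<epsilon> / t) *s (v + t *s \<nu>) \<in> D" if t: "t \<in> T" for t
  proof -
    have t0: "t \<noteq> 0" using t \<rho> by (auto simp: T_def)
    define w where "w = (- complex_of_real \<epsilon> / t) *s (v + t *s \<nu>)"
    have w: "w = (- complex_of_real \<epsilon> / t) *s v + (-\<epsilon>) *\<^sub>R \<nu>"
      unfolding w_def vec_eq_iff using t0
      by (simp add: field_simps scaleR_conv_of_real[where 'a=complex] del: scaleR_minus_left)
    have "norm w \<le> \<epsilon> / norm t * norm v + \<epsilon> * norm \<nu>"
      unfolding w by (rule order_trans[OF norm_triangle_ineq]) (use \<epsilon> in \<open>simp add: norm_vector_smult norm_divide\<close>)
    also have "\<epsilon> / norm t \<le> \<epsilon> / (\<rho>/2)" using t \<rho> \<epsilon> t0 by (intro divide_left_mono) (auto simp: T_def)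
    also have "\<epsilon> / (\<rho>/2) * norm v + \<epsilon> * norm \<nu> = \<epsilon> * (M - 1)"
      by (simp add: M_def algebra_simps)
    also have "\<dots> < \<epsilon> * M" using \<epsilon> by simp
    finally have nw: "norm w < \<epsilon> * M" by (simp add: mult_right_mono)
    also have "\<epsilon> * M < min d1 d2" using M d1(1) d2(1) by (auto simp: \<epsilon>_def min_def)
    finally have nw2: "norm w < d1" "norm w < d2" by auto
    have "L w = - \<epsilon>" unfolding w L.add Lv L.scaleR \<nu> by simp
    then have "\<bar>r (p + w) + \<epsilon>\<bar> \<le> 1 / (2*M) * norm w" using d2(2)[of "p + w"] nw2 r(2) by simp
    also have "\<dots> < 1/(2*M) * (\<epsilon> * M)" using nw M by (intro mult_strict_left_mono) auto
    also have "\<dots> = \<epsilon>/2" using M by simp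
    finally have "r (p + w) < 0" using \<epsilon> by linarith
    moreover have "p + w \<in> U" using d1(2) nw2(1) by (auto simp: subset_iff dist_norm)
    ultimately show ?thesis using U(3) by (auto simp: w_def)
  qed
  define W where "W = {x. fst x \<in> T \<and> p + snd x *s (v + fst x *s \<nu>) \<in> D}"
  have oT: "open T" unfolding T_def by (intro open_Collect_conj open_Collect_less continuous_intros)
  have "W = (fst -` T) \<inter> ((\<lambda>x. p + snd x *s (v + fst x *s \<nu>)) -` D)" by (auto simp: W_def)
  then have oW: "open W"
    by (simp only:) (intro open_Int open_vimage D oT continuous_intros)
  have A: "(t, 1) \<in> W" if "t \<in> T" for t
    using that \<rho>(2) by (auto simp: W_def T_def)
  have fW: "fst ` W = T"
  proof
    show "fst ` W \<subseteq> T" by (auto simp: W_def)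
    show "T \<subseteq> fst ` W" using A by force
  qed
  obtain G where G: "continuous_on W G" "\<And>x. x \<in> W \<Longrightarrow> exp (G x) = snd x"
  proof (rule fibrewise_logarithm[of W snd "\<lambda>_. 1" "\<lambda>_. 0"])
    show "simply_connected {s. (t, s) \<in> W}" for t
      using simply_connected_slice[OF D(1), of p "v + t *s \<nu>"]
      by (cases "t \<in> T") (simp_all add: W_def)
    show "snd x \<noteq> 0" if "x \<in> W" for x using that p by (auto simp: W_def)
  qed (use oW A fW in \<open>auto intro!: continuous_intros\<close>)
  \<comment> \<open>The section parameter at this point is \<open>-\<epsilon>/t\<close>, so dividing
    \<open>-\<epsilon>\<close> by it gives \<open>t\<close>, and \<open>h\<close> is a logarithm of
    \<open>t\<close>.\<close>
  define h where "h t = Ln (- complex_of_real \<epsilon>) - G (t, - complex_of_real \<epsilon> / t)" for t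
  have S: "(t, - complex_of_real \<epsilon> / t) \<in> W" "t \<noteq> 0" if "t \<in> sphere 0 (3/4*\<rho>)" for t
  proof -
    have "t \<in> T" using that \<rho>(1) by (auto simp: T_def)
    then show "(t, - complex_of_real \<epsilon> / t) \<in> W" using B by (auto simp: W_def)
    show "t \<noteq> 0" using that \<rho>(1) by auto
  qed
  show False
  proof (rule no_continuous_logarithm_on_circle[of "3/4*\<rho>" h])
    show "continuous_on (sphere 0 (3/4*\<rho>)) h" unfolding h_def
      by (intro continuous_intros continuous_on_compose2[OF G(1)]) (use S in auto)
    show "exp (h t) = t" if "t \<in> sphere 0 (3/4*\<rho>)" for t
      using S[OF that] G(2)[OF S(1)[OF that]] \<epsilon> by (simp add: h_def exp_diff)
  qed (use \<rho> in simp)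
qed

text \<open>\<open>D\<close> is swept out by the complex lines through one point \<open>q\<close>,
  with the direction as the family parameter. All slices share the base point \<open>q\<close> at
  parameter \<open>0\<close>, so constant base data suffice; the logarithm at \<open>w\<close> is
  read off in direction \<open>w - q\<close> at parameter \<open>1\<close>.\<close>

lemma C_convex_logarithm:
  fixes D :: "(complex ^ 'n) set" and g :: "complex ^ 'n \<Rightarrow> complex"
  assumes D: "C_convex D" "open D" and g: "continuous_on D g" "\<And>w. w \<in> D \<Longrightarrow> g w \<noteq> 0"
  obtains G where "continuous_on D G" "\<And>w. w \<in> D \<Longrightarrow> exp (G w) = g w"
proof (cases "D = {}")
  case True
  then show ?thesis using that by auto
next
  case False
  then obtain q where q: "q \<in> D" by auto
  define W where "W = {x. q + snd x *s fst x \<in> D}"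
  have "W = (\<lambda>x. q + snd x *s fst x) -` D" by (auto simp: W_def)
  then have oW: "open W" by (simp only:) (intro open_vimage D continuous_intros)
  obtain G where G: "continuous_on W G" "\<And>x. x \<in> W \<Longrightarrow> exp (G x) = g (q + snd x *s fst x)"
  proof (rule fibrewise_logarithm[of W "\<lambda>x. g (q + snd x *s fst x)" "\<lambda>_. 0" "\<lambda>_. Ln (g q)"])
    show "simply_connected {s. (t, s) \<in> W}" for t
      using simply_connected_slice[OF D(1), of q t] by (simp add: W_def)
    show "continuous_on W (\<lambda>x. g (q + snd x *s fst x))"
      by (rule continuous_on_compose2[OF g(1)]) (auto simp: W_def intro!: continuous_intros)
  qed (use oW q g(2) in \<open>auto simp: W_def\<close>)
  show ?thesis
  proof
    show "continuous_on D (\<lambda>w. G (w - q, 1))"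
      by (rule continuous_on_compose2[OF G(1)]) (auto simp: W_def intro!: continuous_intros)
    show "exp (G (w - q, 1)) = g w" if "w \<in> D" for w
      using G(2)[of "(w - q, 1)"] that by (simp add: W_def)
  qed
qed

section \<open>Bounded holomorphic functions with large derivative\<close>

text \<open>Near \<open>w\<close>, where \<open>g / g w\<close> has positive real part,
  \<open>G\<close> coincides with \<open>G w + Ln (g / g w)\<close>, so a merely continuous
  logarithm inherits the differentiability of \<open>g\<close>.\<close>

lemma logarithm_has_derivative:
  fixes g G :: "complex ^ 'n \<Rightarrow> complex"
  assumes D: "open D" and G: "continuous_on D G" "\<And>w. w \<in> D \<Longrightarrow> exp (G w) = g w"
    and g: "(g has_derivative L) (at w)" and w: "w \<in> D"
  shows "(G has_derivative (\<lambda>v. L v / g w)) (at w)"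
proof -
  have gw: "g w \<noteq> 0" using G(2)[OF w] by (metis exp_not_eq_zero)
  have cg: "continuous_on D (\<lambda>x. g x / g w)"
  proof (rule continuous_on_eq)
    show "continuous_on D (\<lambda>x. exp (G x) / g w)" using gw by (intro continuous_intros G(1)) auto
  qed (simp add: G(2))
  have "open (D \<inter> (\<lambda>x. g x / g w) -` {z. Re z > 0})"
    using continuous_open_preimage[OF cg D open_halfspace_Re_gt] .
  moreover have "w \<in> D \<inter> (\<lambda>x. g x / g w) -` {z. Re z > 0}" using gw w by simp
  ultimately obtain e where e: "e > 0" "ball w e \<subseteq> D \<inter> (\<lambda>x. g x / g w) -` {z. Re z > 0}"
    by (meson open_contains_ball)
  have Re_pos: "Re (g x / g w) > 0" if "x \<in> ball w e" for x
    using e(2) that by auto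
  have G_eq: "G w + Ln (g x / g w) = G x" if x: "x \<in> ball w e" for x
  proof -
    have "G x - Ln (g x / g w) - G w = G w - Ln (g w / g w) - G w"
    proof (rule exp_eq_1_constant[of "ball w e" "\<lambda>y. G y - Ln (g y / g w) - G w"])
      have "continuous_on (ball w e) (\<lambda>y. Ln (g y / g w))"
        by (rule continuous_on_Ln'[OF continuous_on_subset[OF cg]])
          (use e Re_pos in \<open>force simp: complex_nonpos_Reals_iff\<close>)+
      moreover have "continuous_on (ball w e) G" using e(2) by (intro continuous_on_subset[OF G(1)]) auto
      ultimately show "continuous_on (ball w e) (\<lambda>y. G y - Ln (g y / g w) - G w)"
        by (intro continuous_on_diff continuous_on_const)
      show "exp (G u - Ln (g u / g w) - G w) = 1" if u: "u \<in> ball w e" for u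
      proof -
        have "g u / g w \<noteq> 0" using Re_pos[OF u] by auto
        moreover have "u \<in> D" using e(2) u by auto
        ultimately show ?thesis using G(2)[of u] G(2)[OF w] by (simp add: exp_diff)
      qed
    qed (use x e in auto)
    then show ?thesis using gw by (simp add: algebra_simps)
  qed
  have "((\<lambda>x. g x / g w) has_derivative (\<lambda>v. L v / g w)) (at w)"
    using bounded_linear.has_derivative[OF bounded_linear_divide g] .
  moreover have "(Ln has_derivative (*) 1) (at (g w / g w))"
    using has_field_derivative_Ln[of "g w / g w"] gw
    by (simp add: has_field_derivative_def complex_nonpos_Reals_iff)
  ultimately have "((\<lambda>x. Ln (g x / g w)) has_derivative (\<lambda>v. 1 * (L v / g w))) (at w)"
    by (rule has_derivative_compose)
  then have "((\<lambda>x. G w + Ln (g x / g w)) has_derivative (\<lambda>v. L v / g w)) (at w)"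
    by (auto intro!: derivative_eq_intros)
  then show ?thesis
    by (rule has_derivative_transform_within_open[OF _ open_ball, of _ _ _ _ w e])
      (use e(1) G_eq in auto)
qed

text \<open>The complex line joining \<open>w\<close> and \<open>w'\<close> lies in the fibre of
  \<open>\<phi>\<close>, its section with \<open>D\<close> is connected, and there \<open>G\<close>
  can only vary by multiples of 2 pi i. It makes the square root of the affine function depend on
  the value of that function alone.\<close>

lemma logarithm_eq_on_fibre:
  fixes D :: "(complex ^ 'n) set" and G :: "complex ^ 'n \<Rightarrow> complex"
  assumes D: "C_convex D" and G: "continuous_on D G" "\<And>w. w \<in> D \<Longrightarrow> exp (G w) = \<phi> w + c"
    and \<phi>: "\<And>u v. \<phi> (u + v) = \<phi> u + \<phi> v" "\<And>c v. \<phi> (c *s v) = c * \<phi> v"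
    and w: "w \<in> D" "w' \<in> D" "\<phi> w = \<phi> w'"
  shows "G w = G w'"
proof -
  have \<phi>0: "\<phi> (w' - w) = 0" using \<phi>(1)[of "w' - w" w] w(3) by simp
  have "G (w + 0 *s (w' - w)) - G w = G (w + 1 *s (w' - w)) - G w"
  proof (rule exp_eq_1_constant[of "{s. w + s *s (w' - w) \<in> D}" "\<lambda>s. G (w + s *s (w' - w)) - G w"])
    show "connected {s. w + s *s (w' - w) \<in> D}"
      using simply_connected_slice[OF D] by (rule simply_connected_imp_connected)
    show "continuous_on {s. w + s *s (w' - w) \<in> D} (\<lambda>s. G (w + s *s (w' - w)) - G w)"
      by (intro continuous_intros continuous_on_compose2[OF G(1)]) auto
    show "exp (G (w + u *s (w' - w)) - G w) = 1" if "u \<in> {s. w + s *s (w' - w) \<in> D}" for u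
    proof -
      have "\<phi> w + c \<noteq> 0" using G(2)[OF w(1)] by (metis exp_not_eq_zero)
      moreover have "\<phi> (w + u *s (w' - w)) = \<phi> w" by (simp only: \<phi> \<phi>0) simp
      ultimately show ?thesis using that w(1) G(2) by (simp add: exp_diff del: vector_ssub_ldistrib)
    qed
  qed (use w in auto)
  then show ?thesis by simp
qed

text \<open>A square root \<open>h\<close> of the affine function vanishing on the hyperplane takes no two opposite
  values on \<open>D\<close>. Since \<open>h\<close> covers a disc around \<open>h z\<close>, it omits the opposite disc, and
  \<open>1 / (h + h z)\<close> is bounded.\<close>

lemma ex_bounded_holomorphic_large_derivative:
  fixes D :: "(complex ^ 'n) set"
  assumes D: "C_convex D" "open D"
    and disc: "\<rho> > 0" "\<And>\<zeta>. norm \<zeta> < \<rho> \<Longrightarrow> z + \<zeta> *s X \<in> D"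
    and \<phi>: "bounded_linear \<phi>" "\<And>c v. \<phi> (c *s v) = c * \<phi> v"
    and avoid: "\<And>w. w \<in> D \<Longrightarrow> \<phi> (w - (z + \<mu> *s X)) \<noteq> 0"
  obtains f where "holomorphic_fun_on f D" "f ` D \<subseteq> ball 0 1" "f z = 0"
    "norm (frechet_derivative f (at z) X) = \<rho> / (48 * (norm \<mu>)\<^sup>2)"
proof -
  interpret \<phi>: bounded_linear \<phi> by (rule \<phi>(1))
  have z: "z \<in> D" using disc(2)[of 0] disc(1) by simp
  define g where "g w = \<phi> w + - \<phi> (z + \<mu> *s X)" for w
  have g_alt: "g w = \<phi> (w - (z + \<mu> *s X))" for w by (simp add: g_def \<phi>.diff)
  have g_line: "g (z + \<zeta> *s X) = (\<zeta> - \<mu>) * \<phi> X" for \<zeta>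
    by (simp add: g_def \<phi>.add \<phi>(2) algebra_simps)
  have gz: "g z = - \<mu> * \<phi> X" using g_line[of 0] by simp
  have gnz: "g w \<noteq> 0" if "w \<in> D" for w using avoid[OF that] by (simp add: g_alt)
  have \<mu>: "\<mu> \<noteq> 0" and \<phi>X: "\<phi> X \<noteq> 0" using gnz[OF z] by (auto simp: gz)
  have g': "(g has_derivative \<phi>) (at w)" for w
    unfolding g_def by (auto intro!: derivative_eq_intros \<phi>.has_derivative)
  have cont_g: "continuous_on D g"
    unfolding g_def by (intro continuous_intros \<phi>.continuous_on)
  obtain G where G: "continuous_on D G" "\<And>w. w \<in> D \<Longrightarrow> exp (G w) = g w"
    using C_convex_logarithm[OF D cont_g gnz] by metis
  have fib: "G w = G w'" if "w \<in> D" "w' \<in> D" "g w = g w'" for w w'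
    by (rule logarithm_eq_on_fibre[OF D(1) G(1), where \<phi>=\<phi> and c = "- \<phi> (z + \<mu> *s X)"])
      (use G(2) that in \<open>auto simp: g_def \<phi>.add \<phi>(2)\<close>)
  define h where "h w = exp (G w / 2)" for w
  have h_sq: "(h w)\<^sup>2 = g w" if "w \<in> D" for w
    using G(2)[OF that] by (simp add: h_def flip: exp_double)
  have hnz: "h w \<noteq> 0" for w by (simp add: h_def)
  \<comment> \<open>\<open>\<kappa>\<close> is the relative radius of a disc around
    \<open>h z\<close> covered by \<open>h\<close>. For \<open>m\<close> within
    \<open>\<kappa>\<close> of \<open>1\<close>, with \<open>\<kappa> \<le> 1/3\<close>, the modulus
    of \<open>1 - m\<^sup>2\<close> is below \<open>3 * \<kappa>\<close>, so
    \<open>\<mu> * (1 - m\<^sup>2)\<close> stays in the disc of radius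
    \<open>\<rho>\<close>.\<close>
  define \<kappa> where "\<kappa> = \<rho> / (3 * norm \<mu>)"
  have "\<rho> \<le> norm \<mu>"
  proof (rule ccontr)
    assume "\<not> ?thesis"
    then have "z + \<mu> *s X \<in> D" using disc(2) by simp
    from gnz[OF this] show False by (simp add: g_line)
  qed
  then have \<kappa>: "\<kappa> > 0" "\<kappa> \<le> 1/3" using disc(1) \<mu> by (auto simp: \<kappa>_def divide_simps)
  define R where "R = \<kappa> * norm (h z)"
  have R: "R > 0" using \<kappa> hnz by (simp add: R_def)
  \<comment> \<open>Otherwise \<open>- h w' = m * h z\<close> with \<open>m\<close> close to
    \<open>1\<close>. Along the segment \<open>mt\<close> from \<open>1\<close> to \<open>m\<close>,
    \<open>wt\<close> is the point of the line with \<open>g (wt u) = (mt u)\<^sup>2 * g z\<close>,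
    and continuation gives \<open>h (wt 1) = m * h z = - h w'\<close>. But
    \<open>g (wt 1) = g w'\<close> forces \<open>h (wt 1) = h w'\<close>, and \<open>h\<close> has
    no zero.\<close>
  have omit: "norm (h w' + h z) \<ge> R" if w': "w' \<in> D" for w'
  proof (rule ccontr)
    assume "\<not> ?thesis"
    then have lt: "norm (h w' + h z) < \<kappa> * norm (h z)" by (simp add: R_def)
    define m where "m = - h w' / h z"
    have "m - 1 = - ((h w' + h z) / h z)"
      using hnz[of z] by (simp add: m_def diff_divide_distrib add_divide_distrib)
    then have "norm (m - 1) = norm (h w' + h z) / norm (h z)"
      by (simp only: norm_minus_cancel norm_divide)
    also have "\<dots> < \<kappa>" using lt hnz[of z] by (simp add: divide_simps)
    finally have m: "norm (m - 1) < \<kappa>" .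
    define mt where "mt u = 1 + complex_of_real u * (m - 1)" for u
    define wt where "wt u = z + (\<mu> * (1 - (mt u)\<^sup>2)) *s X" for u
    have mt: "norm (mt u - 1) < \<kappa>" if "u \<in> {0..1}" for u
    proof -
      have "norm (mt u - 1) = u * norm (m - 1)" using that by (simp add: mt_def norm_mult)
      also have "\<dots> \<le> 1 * norm (m - 1)" using that by (intro mult_right_mono) auto
      finally show ?thesis using m by simp
    qed
    have mtpos: "Re (mt u) > 0" if "u \<in> {0..1}" for u
      using mt[OF that] abs_Re_le_cmod[of "mt u - 1"] \<kappa> by simp
    have wtD: "wt u \<in> D" if u: "u \<in> {0..1}" for u
    proof -
      have "norm (1 + mt u) \<le> 3"
        using norm_triangle_ineq[of 2 "mt u - 1"] mt[OF u] \<kappa> by simp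
      then have "norm (mt u - 1) * norm (1 + mt u) < \<kappa> * 3"
        using mt[OF u] \<kappa> by (intro mult_less_le_imp_less) (auto simp: add_eq_0_iff)
      moreover have "norm (\<mu> * (1 - (mt u)\<^sup>2)) = norm \<mu> * (norm (mt u - 1) * norm (1 + mt u))"
        by (simp add: norm_minus_commute[of "mt u"] power2_eq_square algebra_simps flip: norm_mult)
      ultimately have "norm (\<mu> * (1 - (mt u)\<^sup>2)) < norm \<mu> * (\<kappa> * 3)" using \<mu> by simp
      also have "\<dots> = \<rho>" using \<mu> by (simp add: \<kappa>_def)
      finally show ?thesis unfolding wt_def by (rule disc(2))
    qed
    have gwt: "g (wt u) = (mt u)\<^sup>2 * g z" for u
      unfolding wt_def g_line gz by (simp add: algebra_simps)
    have "G (wt 0) - G z - 2 * Ln (mt 0) = G (wt 1) - G z - 2 * Ln (mt 1)"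
    proof (rule exp_eq_1_constant[of "{0..1}" "\<lambda>u. G (wt u) - G z - 2 * Ln (mt u)"])
      have "continuous_on {0..1} (\<lambda>u. G (wt u))"
        by (rule continuous_on_compose2[OF G(1)])
          (use wtD in \<open>auto simp: wt_def mt_def intro!: continuous_intros\<close>)
      moreover have "continuous_on {0..1} (\<lambda>u. Ln (mt u))"
        by (rule continuous_on_Ln')
          (use mtpos in \<open>force simp: complex_nonpos_Reals_iff mt_def intro!: continuous_intros\<close>)+
      ultimately show "continuous_on {0..1} (\<lambda>u. G (wt u) - G z - 2 * Ln (mt u))"
        by (intro continuous_on_diff continuous_on_mult continuous_on_const)
      show "exp (G (wt u) - G z - 2 * Ln (mt u)) = 1" if "u \<in> {0..1}" for u
      proof -
        have "mt u \<noteq> 0" using mtpos[OF that] by auto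
        then show ?thesis using G(2)[OF wtD[OF that]] G(2)[OF z] gnz[OF z]
          by (simp add: exp_diff exp_double gwt)
      qed
    qed auto
    moreover have "mt 0 = 1" "wt 0 = z" "mt 1 = m" by (simp_all add: mt_def wt_def)
    ultimately have "G (wt 1) = G z + 2 * Ln m" by (simp add: diff_eq_eq add.commute)
    moreover have "m \<noteq> 0" by (simp add: m_def hnz)
    ultimately have "h (wt 1) = h z * m" by (simp add: h_def add_divide_distrib exp_add)
    moreover have "g (wt 1) = g w'"
      using gwt[of 1] hnz[of z] by (simp add: mt_def m_def power_divide power_mult_distrib h_sq[OF z, symmetric] h_sq[OF w', symmetric])
    then have "h (wt 1) = h w'" using fib[OF wtD[of 1] w'] by (simp add: h_def)
    ultimately show False using hnz by (simp add: m_def)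
  qed
  have den: "h w + h z \<noteq> 0" if "w \<in> D" for w using omit[OF that] R by auto
  have h': "(h has_derivative (\<lambda>v. h w * (\<phi> v / g w / 2))) (at w)" if w: "w \<in> D" for w
  proof -
    have "(G has_derivative (\<lambda>v. \<phi> v / g w)) (at w)"
      by (rule logarithm_has_derivative[OF D(2) G g' w])
    then have "((\<lambda>w. G w / 2) has_derivative (\<lambda>v. \<phi> v / g w / 2)) (at w)"
      by (rule bounded_linear.has_derivative[OF bounded_linear_divide])
    from has_derivative_compose[OF this, of exp "(*) (exp (G w / 2))"]
    show ?thesis unfolding h_def by (simp add: DERIV_exp flip: has_field_derivative_def)
  qed
  \<comment> \<open>The first quotient has modulus at most \<open>1\<close> by \<open>omit\<close>,
    and its value at \<open>z\<close> has modulus \<open>\<kappa> / 2\<close>. Subtracting that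
    value makes \<open>f z = 0\<close>; halving brings the image into the unit disc.\<close>
  define f where "f w = (R / (h w + h z) - R / (h z + h z)) / 2" for w
  have f': "(f has_derivative (\<lambda>v. - (R * (h w * (\<phi> v / g w / 2)) / (h w + h z)\<^sup>2) / 2)) (at w)"
    if w: "w \<in> D" for w
  proof -
    have "((\<lambda>w. R / (h w + h z)) has_derivative
        (\<lambda>v. - (R * (h w * (\<phi> v / g w / 2)) / (h w + h z)\<^sup>2))) (at w)"
      using has_derivative_divide[OF has_derivative_const[of "complex_of_real R"]
          has_derivative_add[OF h'[OF w] has_derivative_const[of "h z"]] den[OF w]] den[OF w]
      by (simp add: power2_eq_square field_simps)
    from bounded_linear.has_derivative[OF bounded_linear_divide
        has_derivative_diff[OF this has_derivative_const[of "R / (h z + h z)"]], of 2]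
    show ?thesis by (simp add: f_def[abs_def])
  qed
  show ?thesis
  proof
    show "holomorphic_fun_on f D"
      unfolding holomorphic_fun_on_def
    proof (intro ballI exI conjI allI)
      fix w assume "w \<in> D"
      then show "(f has_derivative (\<lambda>v. - (R * (h w * (\<phi> v / g w / 2)) / (h w + h z)\<^sup>2) / 2)) (at w)" by (rule f')
    qed (simp add: \<phi>(2))
    show "f ` D \<subseteq> ball 0 1"
    proof clarsimp
      fix w assume w: "w \<in> D"
      have "norm (R / (h w + h z)) \<le> 1"
        using omit[OF w] den[OF w] R by (simp add: norm_divide divide_simps)
      moreover have "norm (R / (h z + h z)) = \<kappa> / 2"
        using hnz[of z] R \<kappa> by (simp add: norm_divide norm_mult R_def divide_simps flip: mult_2)
      ultimately have "norm (R / (h w + h z) - R / (h z + h z)) < 2"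
        using norm_triangle_ineq4[of "R / (h w + h z)" "R / (h z + h z)"] \<kappa> by simp
      then show "norm (f w) < 1" by (simp add: f_def norm_divide)
    qed
    show "f z = 0" by (simp add: f_def)
    \<comment> \<open>With \<open>g z = (h z)\<^sup>2\<close> the derivative becomes
      \<open>R * \<phi> X / (16 * h z ^ 3)\<close> up to sign; this identity then cancels
      \<open>\<phi> X\<close>, and 48 is 16 times the 3 in \<open>\<kappa>\<close>.\<close>
    have n2: "(norm (h z))\<^sup>2 = norm \<mu> * norm (\<phi> X)"
      using h_sq[OF z] by (metis gz norm_minus_cancel mult_minus_left norm_mult norm_power)
    have "frechet_derivative f (at z) X = - (R * (h z * (\<phi> X / g z / 2)) / (h z + h z)\<^sup>2) / 2"
      using frechet_derivative_at[OF f'[OF z]] by metis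
    also have "\<dots> = - (R * \<phi> X) / (16 * h z ^ 3)"
      using hnz[of z] by (simp add: power2_eq_square power3_eq_cube field_simps flip: h_sq[OF z])
    finally have "norm (frechet_derivative f (at z) X) = R * norm (\<phi> X) / (16 * norm (h z) ^ 3)"
      using R by (simp add: norm_divide norm_mult norm_power)
    also have "\<dots> = \<kappa> * norm (\<phi> X) / (16 * (norm (h z))\<^sup>2)"
      using hnz[of z] by (simp add: R_def power2_eq_square power3_eq_cube)
    also have "\<dots> = \<rho> / (48 * (norm \<mu>)\<^sup>2)"
      unfolding n2 unfolding \<kappa>_def power2_eq_square using \<mu> \<phi>X by (simp add: divide_simps)
    finally show "norm (frechet_derivative f (at z) X) = \<rho> / (48 * (norm \<mu>)\<^sup>2)" .
  qed
qed

section \<open>Comparison of the two metrics\<close>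

lemma holomorphic_disc_has_derivative:
  fixes \<phi> :: "complex \<Rightarrow> complex ^ 'n"
  assumes "holomorphic_disc \<phi>" "\<zeta> \<in> ball 0 1"
  shows "(\<phi> has_derivative (\<lambda>c. c *s disc_deriv \<phi> \<zeta>)) (at \<zeta>)"
proof -
  have lin: "bounded_linear (\<lambda>c. c *s v)" for v :: "complex ^ 'n"
    using linear_smult_left by (simp add: linear_conv_bounded_linear)
  have "((\<lambda>w. \<phi> w $ i) has_derivative (*) (disc_deriv \<phi> \<zeta> $ i)) (at \<zeta>)" for i
    using assms holomorphic_derivI[of "\<lambda>w. \<phi> w $ i" "ball 0 1" \<zeta>]
    by (simp add: holomorphic_disc_def disc_deriv_def has_field_derivative_def)
  then have "((\<lambda>w. \<Sum>i\<in>UNIV. (\<phi> w $ i) *s axis i 1) has_derivative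
      (\<lambda>c. \<Sum>i\<in>UNIV. (disc_deriv \<phi> \<zeta> $ i * c) *s axis i 1)) (at \<zeta>)"
    by (intro has_derivative_sum bounded_linear.has_derivative[OF lin])
  then have "(\<phi> has_derivative (\<lambda>c. \<Sum>i\<in>UNIV. (disc_deriv \<phi> \<zeta> $ i * c) *s axis i 1)) (at \<zeta>)"
    by (simp add: basis_expansion)
  also have "(\<lambda>c. \<Sum>i\<in>UNIV. (disc_deriv \<phi> \<zeta> $ i * c) *s axis i 1) = (\<lambda>c. c *s disc_deriv \<phi> \<zeta>)"
    using basis_expansion[of "c *s disc_deriv \<phi> \<zeta>" for c] by (simp add: mult.commute)
  finally show ?thesis .
qed

text \<open>This is the Schwarz lemma for \<open>f \<circ> \<phi>\<close>, whose derivative at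
  \<open>0\<close> is that of \<open>f\<close> applied to the derivative of the disc.\<close>

lemma caratheodory_candidate_le_kobayashi_candidate:
  assumes f: "holomorphic_fun_on f D" "f ` D \<subseteq> ball 0 1" "f z = 0"
    and \<phi>: "holomorphic_disc \<phi>" "\<phi> ` ball 0 1 \<subseteq> D" "\<phi> 0 = z"
    and \<alpha>: "0 \<le> \<alpha>" "\<alpha> *\<^sub>R disc_deriv \<phi> 0 = X"
  shows "norm (frechet_derivative f (at z) X) \<le> \<alpha>"
proof -
  have fd: "\<exists>L. (f has_derivative L) (at (\<phi> \<zeta>)) \<and> (\<forall>c v. L (c *s v) = c * L v)" if "\<zeta> \<in> ball 0 1" for \<zeta>
  proof -
    have "\<phi> \<zeta> \<in> D" using \<phi>(2) that by blast
    then show ?thesis using f(1) unfolding holomorphic_fun_on_def by blast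
  qed
  have comp: "((f \<circ> \<phi>) has_field_derivative L (disc_deriv \<phi> \<zeta>)) (at \<zeta>)"
    if "\<zeta> \<in> ball 0 1" "(f has_derivative L) (at (\<phi> \<zeta>))" "\<forall>c v. L (c *s v) = c * L v" for \<zeta> L
    using has_derivative_compose[OF holomorphic_disc_has_derivative[OF \<phi>(1) that(1)] that(2)] that(3)
      mult.commute[of "L (disc_deriv \<phi> \<zeta>)"]
    by (simp add: has_field_derivative_def o_def mult_commute_abs)
  obtain L where L: "(f has_derivative L) (at (\<phi> 0))" "\<forall>c v. L (c *s v) = c * L v"
    using fd[of 0] by auto
  have "norm (deriv (f \<circ> \<phi>) 0) \<le> 1"
  proof (rule Schwarz_Lemma(2)[of "f \<circ> \<phi>" 0])
    show "(f \<circ> \<phi>) holomorphic_on ball 0 1"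
      unfolding holomorphic_on_open[OF open_ball] using fd comp by blast
    show "norm ((f \<circ> \<phi>) \<zeta>) < 1" if "norm \<zeta> < 1" for \<zeta>
      using that f(2) \<phi>(2) by (force simp: image_subset_iff)
  qed (use f(3) \<phi>(3) in auto)
  moreover have "deriv (f \<circ> \<phi>) 0 = L (disc_deriv \<phi> 0)"
    using comp[of 0 L] L by (intro DERIV_imp_deriv) auto
  ultimately have "\<alpha> * norm (L (disc_deriv \<phi> 0)) \<le> \<alpha>" using \<alpha>(1) by (simp add: mult_left_le)
  moreover have "frechet_derivative f (at z) X = \<alpha> *\<^sub>R L (disc_deriv \<phi> 0)"
  proof -
    have "frechet_derivative f (at z) = L" using frechet_derivative_at[OF L(1)] \<phi>(3) by simp
    then show ?thesis using \<alpha>(2) has_derivative_bounded_linear[OF L(1)]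
      by (metis linear_simps(5))
  qed
  ultimately show ?thesis using \<alpha>(1) by simp
qed

lemma affine_disc:
  fixes X :: "complex ^ 'n"
  assumes "\<rho> > 0" "\<And>\<zeta>. norm \<zeta> < \<rho> \<Longrightarrow> z + \<zeta> *s X \<in> D"
  shows "\<exists>\<phi>. holomorphic_disc \<phi> \<and> \<phi> ` ball 0 1 \<subseteq> D \<and> \<phi> 0 = z \<and> (1/\<rho>) *\<^sub>R disc_deriv \<phi> 0 = X"
proof (intro exI conjI)
  let ?\<phi> = "\<lambda>\<zeta>. z + (complex_of_real \<rho> * \<zeta>) *s X"
  show "holomorphic_disc ?\<phi>"
    by (auto simp: holomorphic_disc_def intro!: holomorphic_intros)
  show "?\<phi> ` ball 0 1 \<subseteq> D" using assms by (auto simp: norm_mult intro!: assms(2))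
  show "?\<phi> 0 = z" by simp
  have "deriv (\<lambda>w. ?\<phi> w $ i) 0 = of_real \<rho> * X $ i" for i
    by (rule DERIV_imp_deriv) (auto intro!: derivative_eq_intros)
  then have "disc_deriv ?\<phi> 0 $ i = of_real \<rho> * X $ i" for i
    unfolding disc_deriv_def by simp
  then show "(1/\<rho>) *\<^sub>R disc_deriv ?\<phi> 0 = X"
    using assms(1) by (simp add: vec_eq_iff scaleR_conv_of_real[where 'a=complex])
qed

text \<open>The affine disc supplies an element of the Kobayashi set, and that element bounds the
  Caratheodory set above. With the zero function as a competitor, both sets are nonempty and
  bounded, so the real \<open>Sup\<close> and \<open>Inf\<close> obey the expected
  inequalities.\<close>

lemma caratheodory_le_kobayashi_le:
  fixes X :: "complex ^ 'n"
  assumes "\<rho> > 0" "\<And>\<zeta>. norm \<zeta> < \<rho> \<Longrightarrow> z + \<zeta> *s X \<in> D"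
  shows "caratheodory_metric D z X \<le> kobayashi_metric D z X" "kobayashi_metric D z X \<le> 1 / \<rho>"
    "\<And>f. holomorphic_fun_on f D \<Longrightarrow> f ` D \<subseteq> ball 0 1 \<Longrightarrow> f z = 0 \<Longrightarrow>
       norm (frechet_derivative f (at z) X) \<le> caratheodory_metric D z X"
proof -
  let ?C = "{norm (frechet_derivative f (at z) X) | f. holomorphic_fun_on f D \<and> f ` D \<subseteq> ball 0 1 \<and> f z = 0}"
  let ?K = "{\<alpha>. 0 \<le> \<alpha> \<and> (\<exists>\<phi>. holomorphic_disc \<phi> \<and> \<phi> ` ball 0 1 \<subseteq> D \<and> \<phi> 0 = z \<and> \<alpha> *\<^sub>R disc_deriv \<phi> 0 = X)}"
  have CK: "x \<le> y" if "x \<in> ?C" "y \<in> ?K" for x y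
    using that by (elim CollectE exE conjE) (simp only: caratheodory_candidate_le_kobayashi_candidate)
  have K: "1 / \<rho> \<in> ?K" using affine_disc[OF assms] assms(1) by simp
  have bdd: "bdd_above ?C" "bdd_below ?K"
    by (rule bdd_aboveI, erule CK[OF _ K]) (rule bdd_belowI[of _ 0], blast)
  have "holomorphic_fun_on (\<lambda>_. 0) D"
    unfolding holomorphic_fun_on_def by (intro ballI exI[of _ "\<lambda>_. 0"]) auto
  then have "norm (frechet_derivative (\<lambda>_. 0::complex) (at z) X) \<in> ?C"
    by (intro CollectI exI[of _ "\<lambda>_. 0"] conjI refl) auto
  then have "?C \<noteq> {}" by blast
  then show "caratheodory_metric D z X \<le> kobayashi_metric D z X"
    unfolding caratheodory_metric_def kobayashi_metric_def
    using CK K by (intro cSup_least cInf_greatest) blast+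
  show "kobayashi_metric D z X \<le> 1 / \<rho>"
    unfolding kobayashi_metric_def by (rule cInf_lower[OF K bdd(2)])
  show "norm (frechet_derivative f (at z) X) \<le> caratheodory_metric D z X"
    if "holomorphic_fun_on f D" "f ` D \<subseteq> ball 0 1" "f z = 0" for f
    unfolding caratheodory_metric_def
    by (rule cSup_upper[OF _ bdd(1)]) (use that in blast)
qed

section \<open>Smooth functions and their order of vanishing\<close>

lemma iter_deriv_append: "iter_deriv f (vs @ ws) = iter_deriv (iter_deriv f ws) vs"
  by (induction vs) simp_all

lemma smooth_on_iter_deriv: "smooth_on f U \<Longrightarrow> smooth_on (iter_deriv f ws) U"
  by (simp add: smooth_on_def flip: iter_deriv_append)

lemma smooth_on_has_derivative:
  assumes "smooth_on f U" "x \<in> U"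
  shows "(f has_derivative (\<lambda>v. iter_deriv f [v] x)) (at x)"
proof -
  have "iter_deriv f [] differentiable (at x)" using assms unfolding smooth_on_def by blast
  then show ?thesis by (simp add: frechet_derivative_works)
qed

lemma smooth_on_continuous_at: "smooth_on f U \<Longrightarrow> x \<in> U \<Longrightarrow> isCont f x"
  using smooth_on_has_derivative has_derivative_continuous by blast

text \<open>The chain rule for all orders at once; with \<open>A \<zeta> = \<zeta> *s X\<close> it
  transfers smoothness of \<open>r\<close> to its restriction to a complex line.\<close>

lemma
  assumes f: "smooth_on f U" "open U" and A: "bounded_linear A"
  shows iter_deriv_affine: "a + A x \<in> U \<Longrightarrow> iter_deriv (\<lambda>x. f (a + A x)) vs x = iter_deriv f (map A vs) (a + A x)"
    and smooth_on_affine: "smooth_on (\<lambda>x. f (a + A x)) {x. a + A x \<in> U}"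
proof -
  let ?V = "(\<lambda>x. a + A x) -` U"
  have V: "open ?V"
    by (rule open_vimage[OF f(2)]) (intro continuous_intros linear_continuous_on A)
  have der: "((\<lambda>x. iter_deriv f ws (a + A x)) has_derivative (\<lambda>v. iter_deriv f (A v # ws) (a + A x))) (at x)"
    if x: "a + A x \<in> U" for ws x
  proof -
    have "((\<lambda>x. a + A x) has_derivative A) (at x)"
      by (auto intro!: derivative_eq_intros bounded_linear_imp_has_derivative A)
    from has_derivative_compose[OF this smooth_on_has_derivative[OF smooth_on_iter_deriv[OF f(1)] x]]
    show ?thesis by simp
  qed
  have eq: "iter_deriv (\<lambda>x. f (a + A x)) vs x = iter_deriv f (map A vs) (a + A x)" if "a + A x \<in> U" for vs x
    using that
  proof (induction vs arbitrary: x)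
    case (Cons v vs)
    have "(iter_deriv (\<lambda>x. f (a + A x)) vs has_derivative (\<lambda>v. iter_deriv f (A v # map A vs) (a + A x))) (at x)"
      by (rule has_derivative_transform_within_open[OF der V]) (use Cons in auto)
    from frechet_derivative_at[OF this] show ?case by (simp add: fun_eq_iff)
  qed simp
  show "a + A x \<in> U \<Longrightarrow> iter_deriv (\<lambda>x. f (a + A x)) vs x = iter_deriv f (map A vs) (a + A x)"
    by (rule eq)
  show "smooth_on (\<lambda>x. f (a + A x)) {x. a + A x \<in> U}"
    unfolding smooth_on_def
  proof (intro allI ballI)
    fix vs x assume x: "x \<in> {x. a + A x \<in> U}"
    have "(iter_deriv (\<lambda>x. f (a + A x)) vs has_derivative (\<lambda>v. iter_deriv f (A v # map A vs) (a + A x))) (at x)"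
      by (rule has_derivative_transform_within_open[OF der V]) (use x eq in auto)
    then show "iter_deriv (\<lambda>x. f (a + A x)) vs differentiable at x"
      by (auto simp: differentiable_def)
  qed
qed

text \<open>Taylor's bound by induction on \<open>k\<close>: the first partial derivatives vanish to
  one order less, and the mean value inequality on the ball of radius \<open>norm (y - x)\<close>
  regains the missing factor.\<close>

lemma smooth_vanishing_bound:
  fixes f :: "'a::euclidean_space \<Rightarrow> real"
  assumes "smooth_on f U" "open U" "x \<in> U" "\<And>vs. length vs < k \<Longrightarrow> iter_deriv f vs x = 0"
  shows "\<exists>C. eventually (\<lambda>y. \<bar>f y\<bar> \<le> C * norm (y - x) ^ k) (nhds x)"
  using assms
proof (induction k arbitrary: f)
  case 0
  have "(f \<longlongrightarrow> f x) (nhds x)"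
    using smooth_on_continuous_at[OF 0(1,3)] by (simp add: isCont_def tendsto_at_iff_tendsto_nhds)
  then have "eventually (\<lambda>y. dist (f y) (f x) < 1) (nhds x)" by (rule tendstoD) simp
  then have "eventually (\<lambda>y. \<bar>f y\<bar> \<le> (\<bar>f x\<bar> + 1) * norm (y - x) ^ 0) (nhds x)"
    by (rule eventually_mono) (auto simp: dist_real_def)
  then show ?case by blast
next
  case (Suc k)
  have "\<exists>C. eventually (\<lambda>y. \<bar>iter_deriv f [b] y\<bar> \<le> C * norm (y - x) ^ k) (nhds x)" for b
    by (rule Suc.IH[OF smooth_on_iter_deriv[OF Suc.prems(1)] Suc.prems(2,3)])
      (simp add: Suc.prems(4) del: iter_deriv.simps flip: iter_deriv_append)
  then obtain C where C: "\<And>b. eventually (\<lambda>y. \<bar>iter_deriv f [b] y\<bar> \<le> C b * norm (y - x) ^ k) (nhds x)"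
    by metis
  have "eventually (\<lambda>y. \<forall>b\<in>Basis. \<bar>iter_deriv f [b] y\<bar> \<le> C b * norm (y - x) ^ k) (nhds x)"
    by (intro eventually_ball_finite ballI C) auto
  moreover have "eventually (\<lambda>y. y \<in> U) (nhds x)" using Suc.prems by (simp add: eventually_nhds_in_open)
  ultimately have "eventually (\<lambda>y. y \<in> U \<and> (\<forall>b\<in>Basis. \<bar>iter_deriv f [b] y\<bar> \<le> C b * norm (y - x) ^ k)) (nhds x)"
    by eventually_elim auto
  then obtain \<delta> where \<delta>: "\<delta> > 0"
    "\<And>y. dist y x < \<delta> \<Longrightarrow> y \<in> U \<and> (\<forall>b\<in>Basis. \<bar>iter_deriv f [b] y\<bar> \<le> C b * norm (y - x) ^ k)"
    unfolding eventually_nhds_metric by blast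
  define K where "K = (\<Sum>b\<in>Basis. \<bar>C b\<bar>)"
  have fx: "f x = 0" using Suc.prems(4)[of "[]"] by simp
  have "\<bar>f y\<bar> \<le> K * norm (y - x) ^ Suc k" if y: "dist y x < \<delta>" for y
  proof -
    let ?S = "cball x (norm (y - x))"
    have inU: "w \<in> U" "\<And>b. b \<in> Basis \<Longrightarrow> \<bar>iter_deriv f [b] w\<bar> \<le> C b * norm (w - x) ^ k" if "w \<in> ?S" for w
      using that y \<delta>(2)[of w] by (auto simp: dist_norm norm_minus_commute)
    have "norm (f y - f x) \<le> (K * norm (y - x) ^ k) * norm (y - x)"
    proof (rule differentiable_bound[of ?S])
      show "(f has_derivative (\<lambda>v. iter_deriv f [v] w)) (at w within ?S)" if "w \<in> ?S" for w
        using smooth_on_has_derivative[OF Suc.prems(1) inU(1)[OF that]] by (rule has_derivative_at_withinI)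
      show "onorm (\<lambda>v. iter_deriv f [v] w) \<le> K * norm (y - x) ^ k" if w: "w \<in> ?S" for w
      proof (rule onorm_bound)
        show "0 \<le> K * norm (y - x) ^ k" by (simp add: K_def sum_nonneg)
        fix v
        interpret L: bounded_linear "\<lambda>v. iter_deriv f [v] w"
          using smooth_on_has_derivative[OF Suc.prems(1) inU(1)[OF w]] by (rule has_derivative_bounded_linear)
        have "iter_deriv f [v] w = iter_deriv f [\<Sum>b\<in>Basis. (v \<bullet> b) *\<^sub>R b] w" by (simp add: euclidean_representation)
        also have "\<dots> = (\<Sum>b\<in>Basis. (v \<bullet> b) * iter_deriv f [b] w)"
          by (simp only: L.sum L.scaleR real_scaleR_def)
        also have "\<bar>\<dots>\<bar> \<le> (\<Sum>b\<in>Basis. \<bar>(v \<bullet> b) * iter_deriv f [b] w\<bar>)" by (rule sum_abs)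
        also have "\<dots> \<le> (\<Sum>b\<in>Basis. norm v * (\<bar>C b\<bar> * norm (y - x) ^ k))"
        proof (rule sum_mono)
          fix b :: 'a assume b: "b \<in> Basis"
          have "\<bar>iter_deriv f [b] w\<bar> \<le> C b * norm (w - x) ^ k" by (rule inU(2)[OF w b])
          also have "\<dots> \<le> \<bar>C b\<bar> * norm (y - x) ^ k"
            using w by (intro mult_mono power_mono) (auto simp: dist_norm norm_minus_commute)
          finally show "\<bar>(v \<bullet> b) * iter_deriv f [b] w\<bar> \<le> norm v * (\<bar>C b\<bar> * norm (y - x) ^ k)"
            unfolding abs_mult using Basis_le_norm[OF b] by (intro mult_mono) auto
        qed
        also have "\<dots> = K * norm (y - x) ^ k * norm v"
          by (simp add: K_def sum_distrib_left sum_distrib_right mult_ac)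
        finally show "norm (iter_deriv f [v] w) \<le> K * norm (y - x) ^ k * norm v" by simp
      qed
    qed (auto simp: dist_norm norm_minus_commute)
    then show ?thesis using fx by (simp add: mult_ac)
  qed
  then have "eventually (\<lambda>y. \<bar>f y\<bar> \<le> K * norm (y - x) ^ Suc k) (nhds x)"
    unfolding eventually_nhds_metric using \<delta>(1) by blast
  then show ?case by blast
qed

primrec finite_difference :: "('a::real_normed_vector \<Rightarrow> real) \<Rightarrow> 'a list \<Rightarrow> 'a \<Rightarrow> real" where
  "finite_difference f [] x = f x"
| "finite_difference f (v # vs) x = finite_difference f vs (x + v) - finite_difference f vs x"

text \<open>A difference is a signed sum of translates, so differentiation passes through it. The
  ball contains every point at which \<open>f\<close> is sampled.\<close>

lemma finite_difference_has_derivative: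
  fixes f :: "'a::real_normed_vector \<Rightarrow> real"
  assumes "smooth_on f U" "cball x (\<Sum>v\<leftarrow>vs. norm v) \<subseteq> U"
  shows "(finite_difference f vs has_derivative (\<lambda>w. finite_difference (iter_deriv f [w]) vs x)) (at x)"
  using assms(2)
proof (induction vs arbitrary: x)
  case Nil
  have "finite_difference g [] = g" for g :: "'a \<Rightarrow> real" by (rule ext) simp
  with Nil show ?case using smooth_on_has_derivative[OF assms(1), of x] by simp
next
  case (Cons v vs)
  let ?s = "\<Sum>v\<leftarrow>vs. norm v"
  have "cball x ?s \<subseteq> cball x (norm v + ?s)" by (intro subset_cball) simp
  moreover have "cball (x + v) ?s \<subseteq> cball x (norm v + ?s)"
  proof
    fix y assume "y \<in> cball (x + v) ?s"
    then show "y \<in> cball x (norm v + ?s)"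
      using dist_triangle[of x y "x + v"] by (simp add: dist_norm)
  qed
  ultimately have 1: "cball x ?s \<subseteq> U" "cball (x + v) ?s \<subseteq> U"
    using Cons.prems by auto
  have fd: "finite_difference g (v # vs) = (\<lambda>x. finite_difference g vs (x + v) - finite_difference g vs x)"
    for g :: "'a \<Rightarrow> real" by (rule ext) simp
  have "((\<lambda>x. x + v) has_derivative (\<lambda>w. w)) (at x)" by (auto intro!: derivative_eq_intros)
  from has_derivative_compose[OF this Cons.IH[OF 1(2)]]
  have "((\<lambda>x. finite_difference f vs (x + v)) has_derivative (\<lambda>w. finite_difference (iter_deriv f [w]) vs (x + v))) (at x)" .
  from has_derivative_diff[OF this Cons.IH[OF 1(1)]]
  show ?case unfolding fd .
qed

text \<open>The mean value theorem is applied once per direction. The outermost difference is turned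
  into a derivative first and so becomes the innermost derivative, whence the
  \<open>rev\<close>.\<close>

lemma finite_difference_mean_value:
  assumes "smooth_on f U" "cball x (\<Sum>v\<leftarrow>vs. norm v) \<subseteq> U"
  shows "\<exists>y\<in>cball x (\<Sum>v\<leftarrow>vs. norm v). finite_difference f vs x = iter_deriv f (rev vs) y"
  using assms
proof (induction vs arbitrary: f x)
  case (Cons v vs)
  let ?s = "\<Sum>v\<leftarrow>vs. norm v"
  have sub: "cball (x + t *\<^sub>R v) ?s \<subseteq> cball x (norm v + ?s)" if "t \<in> {0..1}" for t
  proof
    fix y assume y: "y \<in> cball (x + t *\<^sub>R v) ?s"
    have "dist x y \<le> dist x (x + t *\<^sub>R v) + dist (x + t *\<^sub>R v) y" by (rule dist_triangle)
    also have "dist x (x + t *\<^sub>R v) \<le> norm v" using that by (simp add: dist_norm mult_left_le_one_le)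
    finally show "y \<in> cball x (norm v + ?s)" using y by simp
  qed
  have der: "((\<lambda>t. finite_difference f vs (x + t *\<^sub>R v)) has_derivative
      (\<lambda>h. h * finite_difference (iter_deriv f [v]) vs (x + t *\<^sub>R v))) (at t within {0..1})"
    if t: "t \<in> {0..1}" for t
  proof -
    have fd: "(finite_difference f vs has_derivative
        (\<lambda>w. finite_difference (iter_deriv f [w]) vs (x + t *\<^sub>R v))) (at (x + t *\<^sub>R v))"
      using sub[OF t] Cons.prems(2)
      by (intro finite_difference_has_derivative[OF Cons.prems(1)]) auto
    have "((\<lambda>t. x + t *\<^sub>R v) has_derivative (\<lambda>h. h *\<^sub>R v)) (at t within {0..1})"
      by (auto intro!: derivative_eq_intros)
    from has_derivative_compose[OF this fd] show ?thesis
      using linear_simps(5)[OF has_derivative_bounded_linear[OF fd]] by simp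
  qed
  obtain t where t: "t \<in> {0<..<1}"
    "finite_difference f vs (x + 1 *\<^sub>R v) - finite_difference f vs (x + 0 *\<^sub>R v)
      = (1 - 0) * finite_difference (iter_deriv f [v]) vs (x + t *\<^sub>R v)"
    using mvt_simple[of 0 1 "\<lambda>t. finite_difference f vs (x + t *\<^sub>R v)", OF _ der] by auto
  have t01: "t \<in> {0..1}" using t(1) by auto
  have "cball (x + t *\<^sub>R v) ?s \<subseteq> U" using sub[OF t01] Cons.prems(2) by simp
  then obtain y where y: "y \<in> cball (x + t *\<^sub>R v) ?s"
    "finite_difference (iter_deriv f [v]) vs (x + t *\<^sub>R v) = iter_deriv (iter_deriv f [v]) (rev vs) y"
    using Cons.IH[OF smooth_on_iter_deriv[OF Cons.prems(1)]] by blast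
  show ?case
  proof
    show "y \<in> cball x (\<Sum>v\<leftarrow>v # vs. norm v)" using y(1) sub[OF t01] by auto
    show "finite_difference f (v # vs) x = iter_deriv f (rev (v # vs)) y"
      using t(2) y(2) by (simp add: iter_deriv_append)
  qed
qed simp

lemma finite_difference_bound:
  assumes "\<And>y. y \<in> cball x (\<Sum>v\<leftarrow>vs. norm v) \<Longrightarrow> \<bar>f y\<bar> \<le> B"
  shows "\<bar>finite_difference f vs x\<bar> \<le> 2 ^ length vs * B"
  using assms
proof (induction vs arbitrary: x)
  case (Cons v vs)
  have "\<bar>f y\<bar> \<le> B" if "y \<in> cball (x + v) (\<Sum>v\<leftarrow>vs. norm v)" for y
  proof (rule Cons.prems)
    have "dist x y \<le> dist x (x + v) + dist (x + v) y" by (rule dist_triangle)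
    then show "y \<in> cball x (\<Sum>v\<leftarrow>v # vs. norm v)" using that by (simp add: dist_norm)
  qed
  moreover have "\<bar>f y\<bar> \<le> B" if "y \<in> cball x (\<Sum>v\<leftarrow>vs. norm v)" for y
    by (rule Cons.prems) (use that norm_ge_zero[of v] in \<open>simp add: add_increasing\<close>)
  ultimately show ?case using Cons.IH[of x] Cons.IH[of "x + v"] by (simp add: abs_le_iff)
qed simp

lemma iter_deriv_scaleR:
  assumes "smooth_on f U" "open U" "x \<in> U"
  shows "iter_deriv f (map ((*\<^sub>R) h) vs) x = h ^ length vs * iter_deriv f vs x"
  using assms(3)
proof (induction vs arbitrary: x)
  case (Cons v vs)
  have d: "(iter_deriv f vs has_derivative (\<lambda>v. iter_deriv f (v # vs) x)) (at x)"
    using smooth_on_has_derivative[OF smooth_on_iter_deriv[OF assms(1)] Cons.prems] by simp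
  have "(iter_deriv f (map ((*\<^sub>R) h) vs) has_derivative (\<lambda>v. h ^ length vs * iter_deriv f (v # vs) x)) (at x)"
    by (rule has_derivative_transform_within_open[OF has_derivative_mult_right[OF d] assms(2) Cons.prems])
      (simp add: Cons.IH)
  from frechet_derivative_at[OF this]
  have "iter_deriv f ((h *\<^sub>R v) # map ((*\<^sub>R) h) vs) x = h ^ length vs * iter_deriv f ((h *\<^sub>R v) # vs) x"
    by (simp add: fun_eq_iff)
  also have "iter_deriv f ((h *\<^sub>R v) # vs) x = h * iter_deriv f (v # vs) x"
    using linear_simps(5)[OF has_derivative_bounded_linear[OF d]] by simp
  finally show ?case by simp
qed simp

text \<open>The iterated difference with steps \<open>h *\<^sub>R v\<close> is
  \<open>h ^ length vs\<close> times a derivative near \<open>x\<close>, which keeps at least half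
  its size. It is also a signed sum of \<open>2 ^ length vs\<close> values of \<open>f\<close>, so
  one of these must be large; these two factors make up the denominator of \<open>c\<close>.\<close>

lemma smooth_nonvanishing_lower_bound:
  fixes f :: "'a::real_normed_vector \<Rightarrow> real"
  assumes f: "smooth_on f U" "open U" "x \<in> U" and vs: "iter_deriv f vs x \<noteq> 0"
  obtains M c \<eta> where "M > 0" "c > 0" "\<eta> > 0"
    "\<And>h. 0 < h \<Longrightarrow> h < \<eta> \<Longrightarrow> \<exists>y. norm (y - x) \<le> M * h \<and> c * h ^ length vs \<le> \<bar>f y\<bar>"
proof -
  define M where "M = (\<Sum>v\<leftarrow>vs. norm v) + 1"
  have M: "M > 0" unfolding M_def by (intro add_nonneg_pos sum_list_nonneg) auto
  define c where "c = \<bar>iter_deriv f vs x\<bar> / (2 * 2 ^ length vs)"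
  have c: "c > 0" using vs by (simp add: c_def)
  have "isCont (iter_deriv f vs) x"
    by (rule smooth_on_continuous_at[OF smooth_on_iter_deriv[OF f(1)] f(3)])
  then have "(iter_deriv f vs \<longlongrightarrow> iter_deriv f vs x) (nhds x)"
    by (simp add: isCont_def tendsto_at_iff_tendsto_nhds)
  then have "eventually (\<lambda>y. dist (iter_deriv f vs y) (iter_deriv f vs x) < \<bar>iter_deriv f vs x\<bar>/2) (nhds x)"
    using vs by (intro tendstoD) auto
  moreover have "eventually (\<lambda>y. y \<in> U) (nhds x)" using f by (simp add: eventually_nhds_in_open)
  ultimately have "eventually (\<lambda>y. y \<in> U \<and> \<bar>iter_deriv f vs x\<bar>/2 < \<bar>iter_deriv f vs y\<bar>) (nhds x)"
    by eventually_elim (auto simp: dist_real_def abs_if split: if_splits)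
  then obtain \<delta> where \<delta>: "\<delta> > 0"
    "\<And>y. dist y x < \<delta> \<Longrightarrow> y \<in> U \<and> \<bar>iter_deriv f vs x\<bar>/2 < \<bar>iter_deriv f vs y\<bar>"
    unfolding eventually_nhds_metric by blast
  have *: "\<exists>y. norm (y - x) \<le> M * h \<and> c * h ^ length vs \<le> \<bar>f y\<bar>" if h: "0 < h" "h < \<delta> / M" for h
  proof (rule ccontr)
    assume neg: "\<not> ?thesis"
    let ?ws = "rev (map ((*\<^sub>R) h) vs)"
    have "(\<Sum>v\<leftarrow>?ws. norm v) = h * (\<Sum>v\<leftarrow>vs. norm v)"
      using h by (induction vs) (simp_all add: algebra_simps)
    also have "\<dots> \<le> M * h" using h by (simp add: M_def algebra_simps)
    finally have le: "(\<Sum>v\<leftarrow>?ws. norm v) \<le> M * h" .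
    have lt: "M * h < \<delta>" using h M by (simp add: field_simps)
    have "cball x (\<Sum>v\<leftarrow>?ws. norm v) \<subseteq> U" using le lt \<delta>(2) by (auto simp: dist_commute)
    from finite_difference_mean_value[OF f(1) this]
    obtain y where y: "dist y x \<le> M * h" "finite_difference f ?ws x = iter_deriv f (rev ?ws) y"
      using le by (metis dist_commute mem_cball order_trans)
    have "y \<in> U" using \<delta>(2) y(1) lt by simp
    then have eq: "finite_difference f ?ws x = h ^ length vs * iter_deriv f vs y"
      using y(2) iter_deriv_scaleR[OF f(1,2)] by simp
    have "\<bar>finite_difference f ?ws x\<bar> \<le> 2 ^ length ?ws * (c * h ^ length vs)"
    proof (rule finite_difference_bound)
      fix y assume "y \<in> cball x (\<Sum>v\<leftarrow>?ws. norm v)"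
      then have "norm (y - x) \<le> M * h" using le by (simp add: dist_norm norm_minus_commute)
      then show "\<bar>f y\<bar> \<le> c * h ^ length vs" using neg by (meson not_le less_imp_le)
    qed
    also have "2 ^ length ?ws * (c * h ^ length vs) = h ^ length vs * (\<bar>iter_deriv f vs x\<bar> / 2)" by (simp add: c_def)
    also have "\<dots> < h ^ length vs * \<bar>iter_deriv f vs y\<bar>"
      using \<delta>(2)[of y] y(1) lt h by (intro mult_strict_left_mono) auto
    finally show False using h by (simp add: eq abs_mult)
  qed
  show ?thesis
    by (rule that[OF M c _ *]) (use \<delta>(1) M in auto)
qed

lemma vanishing_order_eq_enatD:
  assumes "vanishing_order f x = enat l"
  shows "\<exists>vs. length vs = l \<and> iter_deriv f vs x \<noteq> 0" "\<And>vs. length vs < l \<Longrightarrow> iter_deriv f vs x = 0"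
proof -
  let ?S = "{enat (length vs) | vs. iter_deriv f vs x \<noteq> 0}"
  have "?S \<noteq> {}" using assms by (auto simp: vanishing_order_def Inf_enat_def split: if_splits)
  then have "Inf ?S \<in> ?S" unfolding Inf_enat_def by (auto intro: LeastI)
  then show "\<exists>vs. length vs = l \<and> iter_deriv f vs x \<noteq> 0"
    using assms by (auto simp: vanishing_order_def)
  show "iter_deriv f vs x = 0" if "length vs < l" for vs
  proof (rule ccontr)
    assume "iter_deriv f vs x \<noteq> 0"
    then have "Inf ?S \<le> enat (length vs)" by (intro Inf_lower) auto
    then show False using assms that by (simp add: vanishing_order_def)
  qed
qed

section \<open>Order of contact with a complex line\<close>

context
  fixes D :: "(complex ^ 'n) set" and r :: "complex ^ 'n \<Rightarrow> real" and U :: "(complex ^ 'n) set"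
  assumes D: "open D" and U: "open U" "smooth_on r U" "D \<inter> U = {z \<in> U. r z < 0}"
begin

text \<open>An open set misses its frontier, which excludes \<open>r b < 0\<close>; if
  \<open>r b > 0\<close>, then \<open>r\<close> would be positive near \<open>b\<close> and a whole
  neighbourhood would miss \<open>D\<close>.\<close>

lemma frontier_defining_function:
  assumes b: "b \<in> frontier D" "b \<in> U"
  shows "b \<notin> D" "r b = 0"
proof -
  show nD: "b \<notin> D" using b(1) D by (auto simp: frontier_def interior_open)
  have "r b \<ge> 0" using nD U(3) b(2) by force
  moreover have "\<not> r b > 0"
  proof
    assume pos: "r b > 0"
    have "(r \<longlongrightarrow> r b) (nhds b)"
      using smooth_on_continuous_at[OF U(2) b(2)] by (simp add: isCont_def tendsto_at_iff_tendsto_nhds)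
    then have "eventually (\<lambda>y. r y > 0) (nhds b)" using pos by (rule order_tendstoD)
    moreover have "eventually (\<lambda>y. y \<in> U) (nhds b)" using U(1) b(2) by (simp add: eventually_nhds_in_open)
    ultimately have "eventually (\<lambda>y. y \<notin> D) (nhds b)"
      by eventually_elim (use U(3) in force)
    then obtain S where "open S" "b \<in> S" "\<forall>y\<in>S. y \<notin> D" by (auto simp: eventually_nhds)
    moreover have "b \<in> closure D" using b(1) by (simp add: frontier_def)
    ultimately show False by (auto simp: closure_iff_nhds_not_empty)
  qed
  ultimately show "r b = 0" by simp
qed

lemma tangent_hyperplane_avoids:
  assumes "C_convex D" and b: "b \<in> frontier D" "b \<in> U" "iter_deriv r [v0] b \<noteq> 0"
    and w: "iter_deriv r [w] b = 0" "iter_deriv r [\<i> *s w] b = 0"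
  shows "b + w \<notin> D"
proof (rule tangent_hyperplane_avoids_C_convex[OF assms(1) D _ smooth_on_has_derivative[OF U(2) b(2)]])
  show "b \<notin> D" "r b = 0" using frontier_defining_function[OF b(1,2)] by auto
  show "{z \<in> U. r z < 0} \<subseteq> D" using U(3) by auto
  show "(\<lambda>v. iter_deriv r [v] b) \<noteq> (\<lambda>_. 0)" using b(3) by metis
qed (use U b w in auto)

text \<open>Finite differences only bound the modulus of \<open>r\<close>, so the sign has to come
  from elsewhere: from the tangent hyperplane if \<open>X\<close> is complex tangent, and from a
  nonzero first derivative otherwise.\<close>

lemma line_contact_lower_bound:
  assumes C: "C_convex D" and a: "a \<in> frontier D" "a \<in> U" "iter_deriv r [v0] a \<noteq> 0"
    and l: "line_contact_order r a X = enat l"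
  obtains M c \<eta> where "M > 0" "c > 0" "\<eta> > 0"
    "\<And>s. 0 < s \<Longrightarrow> s < \<eta> \<Longrightarrow> \<exists>\<zeta>. norm \<zeta> \<le> M * s \<and> c * s ^ l \<le> r (a + \<zeta> *s X)"
proof -
  define \<phi> where "\<phi> \<zeta> = r (a + \<zeta> *s X)" for \<zeta>
  define V where "V = {\<zeta>. a + \<zeta> *s X \<in> U}"
  have lin: "bounded_linear (\<lambda>\<zeta>. \<zeta> *s X)"
    using linear_smult_left by (simp add: linear_conv_bounded_linear)
  have sm: "smooth_on \<phi> V" unfolding \<phi>_def V_def by (rule smooth_on_affine[OF U(2,1) lin])
  have "V = (\<lambda>\<zeta>. a + \<zeta> *s X) -` U" by (auto simp: V_def)
  then have oV: "open V" by (simp only:) (intro open_vimage U continuous_intros)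
  have V0: "0 \<in> V" using a by (simp add: V_def)
  have ra: "r a = 0" using frontier_defining_function[OF a(1,2)] by simp
  have \<phi>': "iter_deriv \<phi> [\<omega>] 0 = iter_deriv r [\<omega> *s X] a" for \<omega>
    using iter_deriv_affine[OF U(2,1) lin, of a 0 "[\<omega>]"] a(2) by (simp add: \<phi>_def[abs_def])
  have vo: "vanishing_order \<phi> 0 = enat l" using l by (simp add: line_contact_order_def \<phi>_def[abs_def])
  obtain vs where vs: "length vs = l" "iter_deriv \<phi> vs 0 \<noteq> 0"
    using vanishing_order_eq_enatD(1)[OF vo] by blast
  show ?thesis
  proof (cases "\<forall>\<omega>. iter_deriv r [\<omega> *s X] a = 0")
    case True
    have nonneg: "\<phi> \<zeta> \<ge> 0" if "\<zeta> \<in> V" for \<zeta>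
    proof -
      have "a + \<zeta> *s X \<notin> D"
      proof (rule tangent_hyperplane_avoids[OF C a])
        show "iter_deriv r [\<zeta> *s X] a = 0" using True by blast
        show "iter_deriv r [\<i> *s (\<zeta> *s X)] a = 0"
          unfolding vector_smult_assoc using True by blast
      qed
      moreover have "a + \<zeta> *s X \<in> U" using that by (simp add: V_def)
      ultimately have "\<not> r (a + \<zeta> *s X) < 0" using U(3) by blast
      then show ?thesis by (simp add: \<phi>_def)
    qed
    obtain M c \<eta>1 where Mc: "M > 0" "c > 0" and \<eta>1: "\<eta>1 > 0"
      "\<And>h. 0 < h \<Longrightarrow> h < \<eta>1 \<Longrightarrow> \<exists>y. norm (y - 0) \<le> M * h \<and> c * h ^ length vs \<le> \<bar>\<phi> y\<bar>"
      by (rule smooth_nonvanishing_lower_bound[OF sm oV V0 vs(2)]) (rule that)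
    obtain e where e: "e > 0" "ball 0 e \<subseteq> V" using oV V0 by (meson open_contains_ball)
    show ?thesis
    proof (rule that)
      show "M > 0" "c > 0" "min \<eta>1 (e / M) > 0" using Mc \<eta>1 e by auto
      fix s assume s: "0 < s" "s < min \<eta>1 (e / M)"
      then have "0 < s" "s < \<eta>1" by auto
      from \<eta>1(2)[OF this] obtain y where y: "norm y \<le> M * s" "c * s ^ l \<le> \<bar>\<phi> y\<bar>"
        unfolding vs(1) diff_0_right by blast
      have "M * s < e" using s Mc(1) by (simp add: field_simps)
      then have "y \<in> V" using y(1) e(2) by auto
      then show "\<exists>\<zeta>. norm \<zeta> \<le> M * s \<and> c * s ^ l \<le> r (a + \<zeta> *s X)"
        using y nonneg[of y] by (auto simp: \<phi>_def)
    qed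
  next
    case False
    then obtain \<omega>0 where \<omega>0: "iter_deriv \<phi> [\<omega>0] 0 \<noteq> 0" using \<phi>' by auto
    have "\<not> 1 < l" using vanishing_order_eq_enatD(2)[OF vo, of "[\<omega>0]"] \<omega>0 by auto
    moreover have "l \<noteq> 0" using vs ra by (auto simp: \<phi>_def)
    ultimately have l1: "l = 1" by simp
    have d: "(\<phi> has_derivative (\<lambda>v. iter_deriv \<phi> [v] 0)) (at 0)"
      by (rule smooth_on_has_derivative[OF sm V0])
    have \<phi>0: "\<phi> 0 = 0" using ra by (simp add: \<phi>_def)
    interpret L: bounded_linear "\<lambda>v. iter_deriv \<phi> [v] 0" by (rule has_derivative_bounded_linear[OF d])
    \<comment> \<open>The sign makes the slope \<open>m\<close> positive. With relative error
      \<open>m / (2 * norm \<omega>)\<close>, half of the linear growth survives.\<close>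
    define \<omega> where "\<omega> = (if iter_deriv \<phi> [\<omega>0] 0 > 0 then \<omega>0 else - \<omega>0)"
    define m where "m = iter_deriv \<phi> [\<omega>] 0"
    have m: "m > 0" using \<omega>0 L.neg[of \<omega>0] unfolding m_def \<omega>_def by (auto simp del: iter_deriv.simps)
    have \<omega>: "norm \<omega> > 0" using m L.zero by (auto simp: m_def simp del: iter_deriv.simps)
    obtain e where e: "e > 0"
      "\<And>y. norm (y - 0) < e \<Longrightarrow> norm (\<phi> y - \<phi> 0 - iter_deriv \<phi> [y - 0] 0) \<le> m / (2 * norm \<omega>) * norm (y - 0)"
      using d[unfolded has_derivative_at_alt] m \<omega> by (metis (no_types, lifting) divide_pos_pos mult_pos_pos zero_less_numeral)
    show ?thesis
    proof (rule that)
      show "norm \<omega> > 0" "m / 2 > 0" "e / norm \<omega> > 0" using \<omega> m e by auto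
      fix s assume s: "0 < s" "s < e / norm \<omega>"
      have n: "norm (s *\<^sub>R \<omega>) = norm \<omega> * s" using s by simp
      have "norm \<omega> * s < e" using s \<omega> by (simp add: field_simps)
      then have "\<bar>\<phi> (s *\<^sub>R \<omega>) - \<phi> 0 - s * m\<bar> \<le> m / (2 * norm \<omega>) * (norm \<omega> * s)"
        using e(2)[of "s *\<^sub>R \<omega>"] L.scaleR[of s \<omega>] unfolding diff_0_right n m_def by (simp del: iter_deriv.simps)
      also have "\<dots> = m / 2 * s" using \<omega> by simp
      finally have "m / 2 * s \<le> \<phi> (s *\<^sub>R \<omega>)" using \<phi>0 unfolding abs_le_iff by (simp add: algebra_simps)
      then show "\<exists>\<zeta>. norm \<zeta> \<le> norm \<omega> * s \<and> m / 2 * s ^ l \<le> r (a + \<zeta> *s X)"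
        using n by (intro exI[of _ "s *\<^sub>R \<omega>"]) (auto simp: l1 \<phi>_def)
    qed
  qed
qed

lemma line_contact_upper_bound:
  assumes a: "a \<in> frontier D" "a \<in> U" and l: "line_contact_order r a X = enat l"
  obtains C \<delta> where "C > 0" "\<delta> > 0" "\<And>\<zeta>. norm \<zeta> < \<delta> \<Longrightarrow> r (a + \<zeta> *s X) \<le> C * norm \<zeta> ^ l"
proof -
  define \<phi> where "\<phi> \<zeta> = r (a + \<zeta> *s X)" for \<zeta>
  define V where "V = {\<zeta>. a + \<zeta> *s X \<in> U}"
  have lin: "bounded_linear (\<lambda>\<zeta>. \<zeta> *s X)"
    using linear_smult_left by (simp add: linear_conv_bounded_linear)
  have sm: "smooth_on \<phi> V" unfolding \<phi>_def V_def by (rule smooth_on_affine[OF U(2,1) lin])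
  have "V = (\<lambda>\<zeta>. a + \<zeta> *s X) -` U" by (auto simp: V_def)
  then have oV: "open V" by (simp only:) (intro open_vimage U continuous_intros)
  have V0: "0 \<in> V" using a by (simp add: V_def)
  have vo: "vanishing_order \<phi> 0 = enat l" using l by (simp add: line_contact_order_def \<phi>_def[abs_def])
  obtain C where "eventually (\<lambda>y. \<bar>\<phi> y\<bar> \<le> C * norm (y - 0) ^ l) (nhds 0)"
    using smooth_vanishing_bound[OF sm oV V0 vanishing_order_eq_enatD(2)[OF vo]] by blast
  then obtain \<delta> where \<delta>: "\<delta> > 0" "\<And>y. norm y < \<delta> \<Longrightarrow> \<bar>\<phi> y\<bar> \<le> C * norm y ^ l"
    unfolding eventually_nhds_metric by (auto simp: dist_norm)
  have "\<phi> y \<le> (\<bar>C\<bar> + 1) * norm y ^ l" if "norm y < \<delta>" for y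
  proof -
    have "\<phi> y \<le> C * norm y ^ l" using \<delta>(2)[OF that] by linarith
    also have "\<dots> \<le> (\<bar>C\<bar> + 1) * norm y ^ l" by (intro mult_right_mono) auto
    finally show ?thesis .
  qed
  then show ?thesis using \<delta>(1) unfolding \<phi>_def by (intro that[of "\<bar>C\<bar> + 1" \<delta>]) auto
qed

end

section \<open>Estimates along the inner normal\<close>

text \<open>Every smallness condition on \<open>h\<close> in the main estimate has this shape,
  displacements along \<open>X\<close> being of order \<open>h\<close> and along the normal of order
  \<open>h ^ l\<close>.\<close>

lemma eventually_affine_power_less:
  fixes A B e :: real
  assumes "l \<noteq> 0" "e > 0"
  shows "eventually (\<lambda>h. A * h + B * h ^ l < e) (at_right 0)"
proof -
  have "((\<lambda>h. A * h + B * h ^ l) \<longlongrightarrow> A * 0 + B * 0 ^ l) (at_right 0)"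
    by (intro tendsto_intros)
  then show ?thesis using assms by (intro order_tendstoD(2)[where y = "A * 0 + B * 0 ^ l"]) (auto simp: power_0_left)
qed

theorem corollary5:
  fixes D :: "(complex ^ 'n) set" and a X :: "complex ^ 'n"
    and r :: "complex ^ 'n \<Rightarrow> real" and l :: nat
  assumes "domain D"
    and "C_convex D"
    and "local_defining_function r D a"
    and "X \<noteq> 0"
    and "line_contact_order r a X = enat l"
  shows "\<exists>U c. open U \<and> a \<in> U \<and> 0 < c \<and>
           (\<forall>z \<in> D \<inter> U \<inter> inner_normal r a.
              inverse c * boundary_dist D z powr (- 1 / real l) \<le> caratheodory_metric D z X \<and>
              caratheodory_metric D z X \<le> kobayashi_metric D z X \<and>
              kobayashi_metric D z X \<le> c * boundary_dist D z powr (- 1 / real l))"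
proof -
  have D: "open D" using assms(1) by (simp add: domain_def)
  obtain U where U: "open U" "smooth_on r U" "D \<inter> U = {z \<in> U. r z < 0}"
    and a: "a \<in> frontier D" "a \<in> U" and dr: "frechet_derivative r (at a) \<noteq> (\<lambda>_. 0)"
    using assms(3) by (auto simp: local_defining_function_def)
  have aD: "a \<notin> D" and ra: "r a = 0" using frontier_defining_function[OF D U a] by auto
  have l0: "l \<noteq> 0"
  proof
    assume "l = 0"
    then obtain vs :: "complex list" where "length vs = 0" "iter_deriv (\<lambda>\<zeta>. r (a + \<zeta> *s X)) vs 0 \<noteq> 0"
      using vanishing_order_eq_enatD(1)[of "\<lambda>\<zeta>. r (a + \<zeta> *s X)" 0 l] assms(5)
      by (auto simp: line_contact_order_def)
    then show False using ra by simp
  qed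

  \<comment> \<open>Gradient at \<open>a\<close>, the inner normal, and the decrease of
    \<open>r\<close> along it\<close>
  have der: "(r has_derivative (\<lambda>v. iter_deriv r [v] x)) (at x)" if "x \<in> U" for x
    by (rule smooth_on_has_derivative[OF U(2) that])
  interpret La: bounded_linear "\<lambda>v. iter_deriv r [v] a" by (rule has_derivative_bounded_linear[OF der[OF a(2)]])
  \<comment> \<open>\<open>g\<close> is the real gradient of \<open>r\<close> at \<open>a\<close>.
    It is not normalised: the point \<open>a - t *\<^sub>R g\<close> has distance
    \<open>t * norm g\<close> from \<open>a\<close>.\<close>
  define g where "g = (\<Sum>b\<in>Basis. iter_deriv r [b] a *\<^sub>R b)"
  have g: "iter_deriv r [v] a = v \<bullet> g" for v
  proof -
    have "iter_deriv r [v] a = iter_deriv r [\<Sum>b\<in>Basis. (v \<bullet> b) *\<^sub>R b] a" by (simp add: euclidean_representation)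
    also have "\<dots> = (\<Sum>b\<in>Basis. (v \<bullet> b) * iter_deriv r [b] a)"
      by (simp only: La.sum La.scaleR real_scaleR_def)
    also have "\<dots> = v \<bullet> g"
      unfolding g_def inner_sum_right by (intro sum.cong refl) simp
    finally show ?thesis .
  qed
  have "g \<noteq> 0"
  proof
    assume "g = 0"
    then have "iter_deriv r [v] a = 0" for v using g[of v] by simp
    then show False using dr by (simp add: fun_eq_iff)
  qed
  then have ng: "norm g > 0" by simp
  define N where "N = g \<bullet> g"
  have N: "N > 0" using \<open>g \<noteq> 0\<close> by (simp add: N_def)
  have normal: "\<exists>t\<ge>0. z = a - t *\<^sub>R g" if z: "z \<in> inner_normal r a" for z
  proof -
    obtain t v where tv: "z = a - t *\<^sub>R v" "0 \<le> t" "GDERIV r a :> v"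
      using z unfolding inner_normal_def by blast
    have "(\<lambda>h. h \<bullet> v) = (\<lambda>v. iter_deriv r [v] a)"
      using has_derivative_unique[OF tv(3)[unfolded gderiv_def] der[OF a(2)]] .
    then have "h \<bullet> v = h \<bullet> g" for h using g[of h] by metis
    then have "v = g" using vector_eq_ldot[of v g] by blast
    then show ?thesis using tv by blast
  qed
  obtain \<delta> where \<delta>: "\<delta> > 0" "ball a \<delta> \<subseteq> U"
    "\<And>w. w \<in> ball a \<delta> \<Longrightarrow> N / 2 < iter_deriv r [g] w \<and> iter_deriv r [g] w < 2 * N"
  proof -
    have "isCont (iter_deriv r [g]) a"
      by (rule smooth_on_continuous_at[OF smooth_on_iter_deriv[OF U(2)] a(2)])
    then have "(iter_deriv r [g] \<longlongrightarrow> iter_deriv r [g] a) (nhds a)"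
      by (simp only: isCont_def tendsto_at_iff_tendsto_nhds)
    then have lim: "(iter_deriv r [g] \<longlongrightarrow> N) (nhds a)" by (simp only: g N_def)
    have "eventually (\<lambda>w. N / 2 < iter_deriv r [g] w) (nhds a)" "eventually (\<lambda>w. iter_deriv r [g] w < 2 * N) (nhds a)"
      using order_tendstoD(1)[OF lim, of "N / 2"] order_tendstoD(2)[OF lim, of "2 * N"] N by auto
    moreover have "eventually (\<lambda>w. w \<in> U) (nhds a)" using U(1) a(2) by (simp add: eventually_nhds_in_open)
    ultimately have "eventually (\<lambda>w. w \<in> U \<and> N / 2 < iter_deriv r [g] w \<and> iter_deriv r [g] w < 2 * N) (nhds a)"
      by eventually_elim simp
    then obtain \<delta> where "\<delta> > 0" "\<forall>w. dist w a < \<delta> \<longrightarrow> w \<in> U \<and> N / 2 < iter_deriv r [g] w \<and> iter_deriv r [g] w < 2 * N"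
      unfolding eventually_nhds_metric by blast
    then show ?thesis by (intro that[of \<delta>]) (auto simp: dist_commute simp del: iter_deriv.simps)
  qed
  \<comment> \<open>Near \<open>a\<close> the derivative of \<open>r\<close> in direction
    \<open>g\<close> lies between \<open>N / 2\<close> and \<open>2 * N\<close>, so a shift by
    \<open>- t *\<^sub>R g\<close> lowers \<open>r\<close> by an amount between
    \<open>N / 2 * t\<close> and \<open>2 * N * t\<close>. All constants below are measured against
    these two bounds.\<close>
  have mv: "r w - 2 * N * t \<le> r (w - t *\<^sub>R g) \<and> r (w - t *\<^sub>R g) \<le> r w - N / 2 * t"
    if w: "w \<in> ball a \<delta>" "w - t *\<^sub>R g \<in> ball a \<delta>" and t: "t > 0" for w t
  proof -
    have inb: "w - s *\<^sub>R g \<in> ball a \<delta>" if "s \<in> {0..t}" for s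
    proof -
      have "w - s *\<^sub>R g = (1 - s / t) *\<^sub>R w + (s / t) *\<^sub>R (w - t *\<^sub>R g)"
        using t by (simp add: algebra_simps)
      then show ?thesis using convexD_alt[OF convex_ball w, of "s / t"] that t by simp
    qed
    have fd: "((\<lambda>s. r (w - s *\<^sub>R g)) has_derivative (\<lambda>h. h * - iter_deriv r [g] (w - s *\<^sub>R g))) (at s within {0..t})"
      if "s \<in> {0..t}" for s
    proof -
      have 1: "((\<lambda>s. w - s *\<^sub>R g) has_derivative (\<lambda>h. h *\<^sub>R (- g))) (at s within {0..t})"
        by (auto intro!: derivative_eq_intros)
      have 2: "(r has_derivative (\<lambda>v. iter_deriv r [v] (w - s *\<^sub>R g))) (at (w - s *\<^sub>R g))"
        using der inb[OF that] \<delta>(2) by blast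
      interpret L: bounded_linear "\<lambda>v. iter_deriv r [v] (w - s *\<^sub>R g)" by (rule has_derivative_bounded_linear[OF 2])
      show ?thesis using has_derivative_compose[OF 1 2] unfolding L.scaleR L.neg by simp
    qed
    have "\<exists>s\<in>{0<..<t}. r (w - t *\<^sub>R g) - r (w - 0 *\<^sub>R g) = (t - 0) * - iter_deriv r [g] (w - s *\<^sub>R g)"
      by (rule mvt_simple[OF t]) (rule fd, simp)
    then obtain s where s: "s \<in> {0<..<t}" "r (w - t *\<^sub>R g) - r (w - 0 *\<^sub>R g) = (t - 0) * - iter_deriv r [g] (w - s *\<^sub>R g)"
      by blast
    define G where "G = iter_deriv r [g] (w - s *\<^sub>R g)"
    have "w - s *\<^sub>R g \<in> ball a \<delta>" using inb[of s] s(1) by auto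
    then have "N / 2 < G" "G < 2 * N" using \<delta>(3) unfolding G_def by auto
    then have "t * (N / 2) \<le> t * G" "t * G \<le> t * (2 * N)" using t by (auto intro: mult_left_mono)
    moreover have "r (w - t *\<^sub>R g) = r w - t * G" using s(2) by (simp add: G_def del: iter_deriv.simps)
    ultimately show ?thesis by (simp add: algebra_simps)
  qed

  \<comment> \<open>Choice of the constants\<close>
  obtain K \<delta>1 where K: "K > 0" "\<delta>1 > 0" "\<And>w. norm (w - a) < \<delta>1 \<Longrightarrow> r w \<le> K * norm (w - a)"
  proof -
    obtain C where "eventually (\<lambda>y. \<bar>r y\<bar> \<le> C * norm (y - a) ^ 1) (nhds a)"
      using smooth_vanishing_bound[OF U(2,1) a(2), of 1] ra by auto
    then obtain \<delta>1 where d1: "\<delta>1 > 0" "\<And>y. dist y a < \<delta>1 \<Longrightarrow> \<bar>r y\<bar> \<le> C * norm (y - a)"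
      unfolding eventually_nhds_metric by auto
    have "r w \<le> (\<bar>C\<bar> + 1) * norm (w - a)" if "norm (w - a) < \<delta>1" for w
    proof -
      have "r w \<le> C * norm (w - a)" using d1(2)[of w] that by (auto simp: dist_norm)
      also have "\<dots> \<le> (\<bar>C\<bar> + 1) * norm (w - a)" by (intro mult_right_mono) auto
      finally show ?thesis .
    qed
    then show ?thesis using d1(1) by (intro that[of "\<bar>C\<bar> + 1" \<delta>1]) auto
  qed
  \<comment> \<open>For displacements of norm below \<open>c1 * t\<close>, the bound
    \<open>K\<close> lets \<open>r\<close> rise from \<open>0\<close> by at most
    \<open>N / 4 * t\<close>, less than the guaranteed drop \<open>N / 2 * t\<close>.\<close>
  define c1 where "c1 = N / (4 * K)"
  have c1: "c1 > 0" using N K by (simp add: c1_def)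
  obtain C \<delta>2 where C: "C > 0" "\<delta>2 > 0" "\<And>\<zeta>. norm \<zeta> < \<delta>2 \<Longrightarrow> r (a + \<zeta> *s X) \<le> C * norm \<zeta> ^ l"
    using line_contact_upper_bound[OF D U a assms(5)] by metis
  \<comment> \<open>With \<open>t = h ^ l\<close> this gives
    \<open>C * (c2 * h) ^ l = N / 4 * t\<close>, again below the guaranteed drop.\<close>
  define c2 where "c2 = root l (N / (4 * C))"
  have c2: "c2 > 0" "c2 ^ l = N / (4 * C)" using N C l0 by (auto simp: c2_def)
  have "iter_deriv r [g] a \<noteq> 0" using N unfolding g N_def by simp
  then obtain M c \<eta> where M: "M > 0" "c > 0" "\<eta> > 0"
    "\<And>s. 0 < s \<Longrightarrow> s < \<eta> \<Longrightarrow> \<exists>\<zeta>. norm \<zeta> \<le> M * s \<and> c * s ^ l \<le> r (a + \<zeta> *s X)"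
    using line_contact_lower_bound[OF D U assms(2) a _ assms(5)] by metis
  \<comment> \<open>Here \<open>c * (k * h) ^ l = 3 * N * t\<close> exceeds the largest possible
    drop \<open>2 * N * t\<close>, which produces a point outside \<open>D\<close>.\<close>
  define k where "k = root l (3 * N / c)"
  have k: "k > 0" "k ^ l = 3 * N / c" using N M l0 by (auto simp: k_def)
  \<comment> \<open>In order: the ball around \<open>z\<close> stays where \<open>mv\<close> and
    \<open>K\<close> apply; the disc radius is in the range of \<open>C\<close>; that disc stays
    near \<open>a\<close>; \<open>k * h\<close> is in the range of the lower bound; the segment to
    the point outside \<open>D\<close> stays near \<open>a\<close>.\<close>
  have "eventually (\<lambda>h. 0 * h + (c1 + norm g) * h ^ l < min \<delta> \<delta>1 \<and> c2 * h + 0 * h ^ l < \<delta>2 \<and>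
     (c2 * norm X) * h + norm g * h ^ l < \<delta> \<and> k * h + 0 * h ^ l < \<eta> \<and> (M * k * norm X) * h + norm g * h ^ l < \<delta>) (at_right 0)"
    using \<delta>(1) K(2) C(2) M(3) l0 by (intro eventually_conj eventually_affine_power_less) auto
  then obtain h0 where h0: "h0 > 0"
    "\<And>h. 0 < h \<Longrightarrow> h < h0 \<Longrightarrow> (c1 + norm g) * h ^ l < min \<delta> \<delta>1 \<and> c2 * h < \<delta>2 \<and>
     (c2 * norm X) * h + norm g * h ^ l < \<delta> \<and> k * h < \<eta> \<and> (M * k * norm X) * h + norm g * h ^ l < \<delta>"
    unfolding eventually_at_right_field by auto
  \<comment> \<open>This is \<open>\<rho> / (48 * (norm \<mu>)\<^sup>2)\<close> for
    \<open>\<rho> = c2 * h\<close> and \<open>norm \<mu> = M * k * h\<close>, multiplied by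
    \<open>h\<close>.\<close>
  define c3 where "c3 = c2 / (48 * (M * k)\<^sup>2)"
  have c3: "c3 > 0" using c2 M k by (simp add: c3_def)

  \<comment> \<open>Estimates at the point \<open>z = a - t *\<^sub>R g\<close> with
    \<open>t = h ^ l\<close>\<close>
  have local_est: "c1 * t \<le> boundary_dist D z" "boundary_dist D z \<le> norm g * t"
      "caratheodory_metric D z X \<le> kobayashi_metric D z X" "kobayashi_metric D z X \<le> 1 / (c2 * h)"
      "c3 / h \<le> caratheodory_metric D z X"
    if h: "0 < h" "h < h0" "t = h ^ l" "z = a - t *\<^sub>R g" for h t z
  proof -
    have t: "t > 0" using h by simp
    note small = h0(2)[OF h(1,2), folded h(3)]
    have inball: "z + w \<in> ball a \<delta>" "a + w \<in> ball a \<delta>" if "norm w + t * norm g < \<delta>" for w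
    proof -
      have "norm (w - t *\<^sub>R g) \<le> norm w + t * norm g" using norm_triangle_ineq4[of w "t *\<^sub>R g"] t by simp
      then have "norm (w - t *\<^sub>R g) < \<delta>" using that by simp
      moreover have "a - (z + w) = - (w - t *\<^sub>R g)" by (simp add: h(4))
      ultimately show "z + w \<in> ball a \<delta>" by (simp only: mem_ball dist_norm norm_minus_cancel)
      have "t * norm g \<ge> 0" using t by simp
      then show "a + w \<in> ball a \<delta>" using that by (simp add: dist_norm)
    qed
    have zw: "z + w = (a + w) - t *\<^sub>R g" for w by (simp add: h(4))
    have mvz: "r (a + w) - 2 * N * t \<le> r (z + w)" "r (z + w) \<le> r (a + w) - N / 2 * t"
      if "norm w + t * norm g < \<delta>" for w
      using mv[of "a + w" t] inball[OF that] t unfolding zw[symmetric] by auto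
    have memD: "z + w \<in> D" if "norm w + t * norm g < \<delta>" "r (a + w) < N / 2 * t" for w
    proof -
      have "z + w \<in> U" using inball[OF that(1)] \<delta>(2) by auto
      moreover have "r (z + w) < 0" using mvz[OF that(1)] that(2) by simp
      ultimately show ?thesis using U(3) by blast
    qed
    show "boundary_dist D z \<le> norm g * t"
      using infdist_le[OF a(1), of z] t by (simp add: h(4) dist_norm mult.commute)
    have "ball z (c1 * t) \<subseteq> D"
    proof
      fix y assume y: "y \<in> ball z (c1 * t)"
      define w where "w = y - z"
      have nw: "norm w < c1 * t" using y by (simp add: w_def dist_norm norm_minus_commute)
      have s: "c1 * t + t * norm g < \<delta>" "c1 * t + t * norm g < \<delta>1" using small by (auto simp: algebra_simps)
      have "t * norm g \<ge> 0" using t by simp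
      then have "norm w < \<delta>1" using s(2) nw by linarith
      then have "r (a + w) \<le> K * norm w" using K(3)[of "a + w"] by simp
      also have "\<dots> \<le> K * (c1 * t)" using nw K(1) by (intro mult_left_mono) auto
      also have "\<dots> = N / 4 * t" using K(1) by (simp add: c1_def)
      also have "\<dots> < N / 2 * t" using N t by simp
      finally have "z + w \<in> D" using nw s(1) by (intro memD) auto
      then show "y \<in> D" by (simp add: w_def)
    qed
    then have "c1 * t \<le> dist z y" if "y \<in> frontier D" for y
      using that frontier_disjoint_eq[of D] D by (metis disjoint_iff mem_ball not_le subsetD Int_commute)
    then show "c1 * t \<le> boundary_dist D z"
      using a(1) by (subst infdist_notempty) (auto intro!: cINF_greatest)
    have disc: "z + \<zeta> *s X \<in> D" if \<zeta>: "norm \<zeta> < c2 * h" for \<zeta>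
    proof (rule memD)
      have "norm (\<zeta> *s X) \<le> c2 * h * norm X"
        unfolding norm_vector_smult using \<zeta> by (intro mult_right_mono) auto
      then show "norm (\<zeta> *s X) + t * norm g < \<delta>" using small by (simp add: algebra_simps)
      have "r (a + \<zeta> *s X) \<le> C * norm \<zeta> ^ l" using \<zeta> small by (intro C(3)) auto
      also have "\<dots> \<le> C * (c2 * h) ^ l" using \<zeta> C(1) by (intro mult_left_mono power_mono) auto
      also have "\<dots> = N / 4 * t" using C(1) by (simp add: power_mult_distrib c2(2) h(3))
      also have "\<dots> < N / 2 * t" using N t by simp
      finally show "r (a + \<zeta> *s X) < N / 2 * t" .
    qed
    have \<rho>: "c2 * h > 0" using c2 h by simp
    show "caratheodory_metric D z X \<le> kobayashi_metric D z X" "kobayashi_metric D z X \<le> 1 / (c2 * h)"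
      by (rule caratheodory_le_kobayashi_le[OF \<rho> disc], assumption)+
    have zD: "z \<in> D" using disc[of 0] \<rho> by simp
    have "0 < k * h" "k * h < \<eta>" using k h small by auto
    from M(4)[OF this] obtain \<zeta> where \<zeta>: "norm \<zeta> \<le> M * (k * h)" "c * (k * h) ^ l \<le> r (a + \<zeta> *s X)"
      by blast
    have in_\<delta>: "norm ((complex_of_real u * \<zeta>) *s X) + t * norm g < \<delta>" if "u \<in> {0..1}" for u
    proof -
      have "norm ((complex_of_real u * \<zeta>) *s X) = u * (norm \<zeta> * norm X)"
        using that by (simp add: norm_vector_smult norm_mult)
      also have "\<dots> \<le> 1 * (M * (k * h) * norm X)"
        using that \<zeta>(1) M(1) k(1) h(1) by (intro mult_mono) auto
      finally show ?thesis using small by (simp add: algebra_simps)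
    qed
    have "z + \<zeta> *s X \<notin> D"
    proof
      assume inD: "z + \<zeta> *s X \<in> D"
      have "norm (\<zeta> *s X) + t * norm g < \<delta>" using in_\<delta>[of 1] by simp
      note b = inball[OF this] mvz[OF this]
      have "r (z + \<zeta> *s X) < 0" using inD b(1) \<delta>(2) U(3) by blast
      moreover have "c * (k * h) ^ l = 3 * N * t" using M(2) by (simp add: power_mult_distrib k(2) h(3))
      moreover have "0 < N * t" using N t by simp
      ultimately show False using b(3) \<zeta>(2) by (simp add: algebra_simps)
    qed
    \<comment> \<open>The segment from \<open>z\<close> to the point outside \<open>D\<close> must
      cross the frontier; the crossing point \<open>b\<close> lies on the line through
      \<open>z\<close> in direction \<open>X\<close>, at a parameter \<open>\<mu>\<close> of order
      \<open>h\<close>.\<close>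
    define S where "S = (\<lambda>u. z + (complex_of_real u * \<zeta>) *s X) ` {0..1}"
    have "connected S" unfolding S_def by (intro connected_continuous_image continuous_intros) auto
    moreover have "z \<in> S \<inter> D" unfolding S_def using zD by (auto intro!: image_eqI[of _ _ 0])
    moreover have "z + \<zeta> *s X \<in> S - D" unfolding S_def using \<open>z + \<zeta> *s X \<notin> D\<close>
      by (auto intro!: image_eqI[of _ _ 1])
    ultimately have "S \<inter> frontier D \<noteq> {}" by (intro connected_Int_frontier) auto
    then obtain u where u: "u \<in> {0..1}" "z + (complex_of_real u * \<zeta>) *s X \<in> frontier D"
      unfolding S_def by blast
    define \<mu> where "\<mu> = complex_of_real u * \<zeta>"
    define b where "b = z + \<mu> *s X"
    have bF: "b \<in> frontier D" using u(2) by (simp add: b_def \<mu>_def)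
    have bball: "b \<in> ball a \<delta>" using inball(1)[OF in_\<delta>[OF u(1)]] by (simp add: b_def \<mu>_def)
    then have bU: "b \<in> U" and bg: "iter_deriv r [g] b \<noteq> 0" using \<delta>(2) \<delta>(3)[OF bball] N by auto
    have n\<mu>: "norm \<mu> \<le> M * k * h"
    proof -
      have "norm \<mu> = u * norm \<zeta>" using u(1) by (simp add: \<mu>_def norm_mult)
      also have "\<dots> \<le> 1 * norm \<zeta>" using u(1) by (intro mult_right_mono) auto
      finally show ?thesis using \<zeta>(1) by (simp add: mult_ac)
    qed
    have \<mu>0: "\<mu> \<noteq> 0"
      using bF frontier_defining_function(1)[OF D U bF bU] zD by (auto simp: b_def)
    interpret Lb: bounded_linear "\<lambda>v. iter_deriv r [v] b" by (rule has_derivative_bounded_linear[OF der[OF bU]])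
    \<comment> \<open>\<open>\<phi>\<close> is the complex-linear form with real part the
      differential of \<open>r\<close> at \<open>b\<close>. Its kernel is the complex tangent space
      at \<open>b\<close>, so its zero hyperplane through \<open>b\<close> misses
      \<open>D\<close>.\<close>
    define \<phi> where "\<phi> v = complex_of_real (iter_deriv r [v] b) - \<i> * complex_of_real (iter_deriv r [\<i> *s v] b)" for v
    have lin_i: "linear (\<lambda>v::complex^'n. \<i> *s v)" by (rule linearI) (auto simp: vec_eq_iff algebra_simps)
    have "linear \<phi>"
      by (rule linearI)
        (simp_all only: \<phi>_def linear_add[OF lin_i] linear_scale[OF lin_i] Lb.add Lb.scaleR,
         simp_all add: algebra_simps scaleR_conv_of_real)
    then have "bounded_linear \<phi>" by (simp add: linear_conv_bounded_linear)
    moreover have "\<phi> (c *s v) = c * \<phi> v" for c v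
    proof -
      have e1: "c *s v = Re c *\<^sub>R v + Im c *\<^sub>R (\<i> *s v)" by (auto simp: vec_eq_iff complex_eq_iff)
      have e2: "\<i> *s (c *s v) = Re c *\<^sub>R (\<i> *s v) + (- Im c) *\<^sub>R v" by (auto simp: vec_eq_iff complex_eq_iff)
      show ?thesis unfolding \<phi>_def e2 unfolding e1 Lb.add Lb.scaleR
        by (simp add: complex_eq_iff algebra_simps del: iter_deriv.simps)
    qed
    moreover have "\<phi> (w - (z + \<mu> *s X)) \<noteq> 0" if "w \<in> D" for w
    proof
      assume "\<phi> (w - (z + \<mu> *s X)) = 0"
      then have "iter_deriv r [w - b] b = 0" "iter_deriv r [\<i> *s (w - b)] b = 0"
        by (simp_all add: \<phi>_def b_def complex_eq_iff del: iter_deriv.simps vector_ssub_ldistrib)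
      from tangent_hyperplane_avoids[OF D U assms(2) bF bU bg this] show False using that by simp
    qed
    ultimately obtain f where f: "holomorphic_fun_on f D" "f ` D \<subseteq> ball 0 1" "f z = 0"
      "norm (frechet_derivative f (at z) X) = (c2 * h) / (48 * (norm \<mu>)\<^sup>2)"
      using ex_bounded_holomorphic_large_derivative[OF assms(2) D \<rho> disc, of \<phi> \<mu>] by metis
    have "c3 / h = c2 * h / (48 * (M * k * h)\<^sup>2)"
      using h by (simp add: c3_def power2_eq_square)
    also have "\<dots> \<le> c2 * h / (48 * (norm \<mu>)\<^sup>2)"
      using n\<mu> \<mu>0 \<rho> M k h by (intro divide_left_mono mult_left_mono power_mono mult_pos_pos) auto
    also have "\<dots> \<le> caratheodory_metric D z X"
      using caratheodory_le_kobayashi_le(3)[OF \<rho> disc f(1-3)] f(4) by simp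
    finally show "c3 / h \<le> caratheodory_metric D z X" .
  qed

  \<comment> \<open>From \<open>h\<close> to the \<open>l\<close>-th root of the boundary
    distance\<close>
  define R where "R = root l (norm g)"
  define R1 where "R1 = root l c1"
  have R: "R > 0" "R1 > 0" using ng c1 l0 by (auto simp: R_def R1_def)
  define cc where "cc = max (R / c2) (1 / (c3 * R1))"
  have cc: "cc > 0" using R c2 by (simp add: cc_def less_max_iff_disj)
  show ?thesis
  proof (intro exI conjI ballI)
    \<comment> \<open>On the normal, lying in this ball means \<open>t < h0 ^ l\<close>, that is
      \<open>h < h0\<close> for the \<open>l\<close>-th root \<open>h\<close> of
      \<open>t\<close>.\<close>
    show "open (ball a (h0 ^ l * norm g))" by simp
    show "a \<in> ball a (h0 ^ l * norm g)" using h0(1) ng by simp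
    show "0 < cc" by (rule cc)
    fix z assume z: "z \<in> D \<inter> ball a (h0 ^ l * norm g) \<inter> inner_normal r a"
    then obtain t where t: "t \<ge> 0" "z = a - t *\<^sub>R g" using normal by blast
    have "t \<noteq> 0" using t(2) z aD by auto
    then have t0: "t > 0" using t(1) by simp
    define h where "h = root l t"
    have h: "h > 0" "t = h ^ l" using t0 l0 by (auto simp: h_def)
    have "t * norm g < h0 ^ l * norm g" using z t by (simp add: dist_norm)
    then have "h ^ l < h0 ^ l" using ng h(2) by simp
    then have hh: "h < h0" using h0(1) by (intro power_less_imp_less_base[of h l]) auto
    note est = local_est[OF h(1) hh h(2) t(2)]
    define d where "d = boundary_dist D z"
    have d0: "d > 0" using est(1) c1 t0 unfolding d_def by (smt (verit) mult_pos_pos)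
    define e where "e = root l d"
    have e0: "e > 0" using d0 l0 by (simp add: e_def)
    have e: "d powr (- 1 / real l) = 1 / e"
      using d0 l0 by (simp add: e_def root_powr_inverse powr_minus_divide)
    have "root l (c1 * t) \<le> e" using est(1) l0 by (simp add: e_def d_def)
    \<comment> \<open>Together with \<open>e2\<close> this makes \<open>e\<close>, the
      \<open>l\<close>-th root of the distance, comparable to \<open>h\<close>; \<open>cc\<close>
      absorbs the constants of both comparisons.\<close>
    then have e1: "R1 * h \<le> e" by (simp add: R1_def h_def real_root_mult)
    have "e \<le> root l (norm g * t)" using est(2) l0 by (simp add: e_def d_def)
    then have e2: "e \<le> R * h" by (simp add: R_def h_def real_root_mult)
    show "caratheodory_metric D z X \<le> kobayashi_metric D z X" by (rule est(3))
    have "kobayashi_metric D z X \<le> 1 / (c2 * h)" by (rule est(4))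
    also have "\<dots> \<le> R / c2 * (1 / e)" using e2 e0 c2 h(1) by (simp add: field_simps)
    also have "\<dots> \<le> cc * (1 / e)" using e0 by (intro mult_right_mono) (auto simp: cc_def)
    finally show "kobayashi_metric D z X \<le> cc * boundary_dist D z powr (- 1 / real l)"
      using e by (simp add: d_def)
    have "inverse cc \<le> inverse (1 / (c3 * R1))"
      using R c3 by (intro le_imp_inverse_le) (auto simp: cc_def)
    then have "inverse cc \<le> c3 * R1" by simp
    then have "inverse cc * (1 / e) \<le> c3 * R1 * (1 / e)" using e0 by (intro mult_right_mono) auto
    also have "\<dots> \<le> c3 / h" using e1 e0 c3 h(1) by (simp add: field_simps)
    also have "\<dots> \<le> caratheodory_metric D z X" by (rule est(5))
    finally show "inverse cc * boundary_dist D z powr (- 1 / real l) \<le> caratheodory_metric D z X"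
      using e by (simp add: d_def)
  qed
qed

end
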